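(* Let $0<s<1$, let $(\phi,\psi)$ be a compactly supported $r$-regular orthonormal wavelet system on $\mathbb{R}^n$ with $r\geqslant 1$, with wavelet functions $\{\psi_\epsilon\}_{\epsilon\in\alpha}$, and let $K\subseteq\mathbb{R}^n$ be compact with nonempty interior. For $j_0\in\mathbb{Z}$ and $d\mu=p_\mu(\mathbf{x})d\mathbf{x}$, $d\nu=p_\nu(\mathbf{x})d\mathbf{x}$ in $\mathcal{P}_{\mathrm{ab2}}(K)$ let $$(W_{\mathrm{wav}}^{(\psi,j_0)})_s(\mu,\nu):=\sum_{\epsilon\in\alpha,\ j\geqslant j_0,\ \mathbf{k}\in\mathbb{Z}^n}2^{-j(s+\frac n2)}\,\bigl|(p_\mu-p_\nu)^{(d)}_{(\epsilon,(j,\mathbf{k}))}\bigr|,$$ and let $E_{\psi,s}:=1/\max_{\epsilon\in\alpha}\|\psi_\epsilon\|_{(\dot C^s(\mathbb{R}^n))^*}$. Then the constant $E_{\psi,s}$ is tight in the lower bound "for every $\eta>0$ there exists a sufficiently small $j_0\in\mathbb{Z}$ such that $E_{\psi,s}W_s(\mu,\nu)-\eta\leqslant (W_{\mathrm{wav}}^{(\psi,j_0)})_s(\mu,\nu)$ for all $\mu,\nu\in\mathcal{P}_{\mathrm{ab2}}(K)$". That is, $E_{\psi,s}$ cannot be replaced by a larger constant: if $C>0$ is a constant such that for every $\eta>0$ there exists $j_0\in\mathbb{Z}$ with $C\,W_s(\mu,\nu)-\eta\leqslant (W_{\mathrm{wav}}^{(\psi,j_0)})_s(\mu,\nu)$ for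 all $\mu,\nu\in\mathcal{P}_{\mathrm{ab2}}(K)$, then $C\leqslant E_{\psi,s}$.
   Context: $\mathcal{P}_{\mathrm{ab2}}(K)$ is the set of Borel probability measures on the compact set $K$ that are absolutely continuous with respect to $n$-dimensional Lebesgue measure with square-integrable density (extended by $0$ outside $K$). For $0<s\leqslant 1$, $W_s(\mu,\nu):=\inf_{\gamma\in\Gamma(\mu,\nu)}\int|\mathbf{x}-\mathbf{y}|^s\,d\gamma(\mathbf{x},\mathbf{y})$, where $\Gamma(\mu,\nu)$ is the set of couplings (transport plans) of $\mu$ and $\nu$; there is no power $1/s$. Orthonormal wavelet system. A multiresolution approximation of $L^2(\mathbb{R}^n)$ is an increasing sequence of closed subspaces $\{V_j\}_{j\in\mathbb{Z}}$ such that: (1) $\bigcap_j V_j=\{0\}$ and $\overline{\bigcup_j V_j}=L^2(\mathbb{R}^n)$; (2) for all $f\in L^2(\mathbb{R}^n)$, $j\in\mathbb{Z}$, $\mathbf{k}\in\mathbb{Z}^n$: $f(\mathbf{x})\in V_j\Leftrightarrow f(2\mathbf{x})\in V_{j+1}$, and $f(\mathbf{x})\in V_0\Leftrightarrow f(\mathbf{x}-\mathbf{k})\in V_0$; (3) there is a scaling function $\phi\in V_0$ with integral $1$ such that, for each $j$, the functions $\phi_{(j,\mathbf{k})}(\mathbf{x}):=2^{nj/2}\phi(2^j\mathbf{x}-\mathbf{k})$, $\mathbf{k}\in\mathbb{Z}^n$, form an orthonormal Hilbert basis of $V_j$. Let $W_j$ be the orthogonal complement of $V_j$ in $V_{j+1}$.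 It is an orthonormal wavelet system, denoted $(\phi,\psi)$, if there are functions $\psi_\epsilon\in W_0$, $\epsilon\in\alpha$ ($\alpha$ a finite index set), called wavelet functions, each with integral $0$, such that for each $j$ the functions $\psi_{(\epsilon,(j,\mathbf{k}))}(\mathbf{x}):=2^{nj/2}\psi_\epsilon(2^j\mathbf{x}-\mathbf{k})$, $\epsilon\in\alpha$, $\mathbf{k}\in\mathbb{Z}^n$, form an orthonormal Hilbert basis of $W_j$. The system is $r$-regular if $\phi$ and all $\psi_\epsilon$ are continuously differentiable up to order $r$ and all their derivatives decay faster than the reciprocal of any polynomial at infinity; it is compactly supported if $\phi$ and all $\psi_\epsilon$ are. The detail coefficients of $f$ are $f^{(d)}_{(\epsilon,(j,\mathbf{k}))}:=\int_{\mathbb{R}^n}f(\mathbf{x})\,\overline{\psi_{(\epsilon,(j,\mathbf{k}))}(\mathbf{x})}\,d\mathbf{x}$. $\dot C^s(\mathbb{R}^n)$ is the space of $s$-Hölder continuous functions $f:\mathbb{R}^n\to\mathbb{C}$ modulo constants, normed by the Hölder seminorm $\sup_{\mathbf{x}\neq\mathbf{y}}|f(\mathbf{x})-f(\mathbf{y})|/|\mathbf{x}-\mathbf{y}|^s$, and $\psi_\epsilon$ acts on it by $f\mapsto\int f\psi_\epsilon\,d\mathbf{x}$; that is, $\|\psi_\epsilon\|_{(\dot C^s(\mathbb{R}^n))^*}=\sup\{|\int f\psi_\epsilon\,d\mathbf{x}|: f \text{ has Hölder seminorm}\leqslant 1\}$.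
   Formalization: The wavelet functions are assumed real-valued; for genuinely complex wavelet functions the claim can fail, since the densities are real and only real Hölder test functions matter, so a larger constant than the one given by the dual norm over complex functions is admissible. *)

theory Defs
  imports "HOL-Probability.Probability"
begin

text \<open>
  \<open>L\<^sup>2(\<real>\<^sup>n)\<close> is handled through representatives: its elements are Borel functions, and its
  subspaces are sets of such functions. A set equal to its own \<open>L\<^sup>2\<close>-closure is in particular
  closed under changes on Lebesgue null sets.
\<close>

definition L2_space :: "(real ^ 'n \<Rightarrow> complex) set" where
  "L2_space = {f. f \<in> borel_measurable borel \<and> integrable lborel (\<lambda>x. (cmod (f x))\<^sup>2)}"

definition L2_inner :: "(real ^ 'n \<Rightarrow> complex) \<Rightarrow> (real ^ 'n \<Rightarrow> complex) \<Rightarrow> complex" where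
  "L2_inner f g = (\<integral>x. f x * cnj (g x) \<partial>lborel)"

definition L2_norm :: "(real ^ 'n \<Rightarrow> complex) \<Rightarrow> real" where
  "L2_norm f = sqrt (\<integral>x. (cmod (f x))\<^sup>2 \<partial>lborel)"

definition L2_closure :: "(real ^ 'n \<Rightarrow> complex) set \<Rightarrow> (real ^ 'n \<Rightarrow> complex) set" where
  "L2_closure S = {f \<in> L2_space. \<forall>e>0. \<exists>g\<in>S. L2_norm (\<lambda>x. f x - g x) < e}"

definition closed_L2_subspace :: "(real ^ 'n \<Rightarrow> complex) set \<Rightarrow> bool" where
  "closed_L2_subspace V \<longleftrightarrow>
     V \<subseteq> L2_space \<and> (\<lambda>x. 0) \<in> V \<and>
     (\<forall>f\<in>V. \<forall>g\<in>V. (\<lambda>x. f x + g x) \<in> V) \<and>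
     (\<forall>c. \<forall>f\<in>V. (\<lambda>x. c * f x) \<in> V) \<and>
     L2_closure V = V"

definition orthonormal_hilbert_basis ::
    "('i \<Rightarrow> real ^ 'n \<Rightarrow> complex) \<Rightarrow> 'i set \<Rightarrow> (real ^ 'n \<Rightarrow> complex) set \<Rightarrow> bool" where
  "orthonormal_hilbert_basis b I V \<longleftrightarrow>
     (\<forall>i\<in>I. b i \<in> V) \<and>
     (\<forall>i\<in>I. \<forall>j\<in>I. L2_inner (b i) (b j) = (if i = j then 1 else 0)) \<and>
     V = L2_closure {(\<lambda>x. \<Sum>i\<in>F. c i * b i x) | F c. finite F \<and> F \<subseteq> I}"

definition lattice_vec :: "int ^ 'n \<Rightarrow> real ^ 'n" where
  "lattice_vec k = (\<chi> i. of_int (k $ i))"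

definition dilate :: "(real ^ 'n \<Rightarrow> complex) \<Rightarrow> int \<Rightarrow> int ^ 'n \<Rightarrow> real ^ 'n \<Rightarrow> complex" where
  "dilate f j k x =
     of_real (2 powr (real CARD('n) * of_int j / 2)) * f ((2 powi j) *\<^sub>R x - lattice_vec k)"

definition multiresolution_approximation ::
    "(int \<Rightarrow> (real ^ 'n \<Rightarrow> complex) set) \<Rightarrow> (real ^ 'n \<Rightarrow> complex) \<Rightarrow> bool" where
  "multiresolution_approximation V \<phi> \<longleftrightarrow>
     (\<forall>j. closed_L2_subspace (V j)) \<and> mono V \<and>
     (\<Inter>j. V j) = {f \<in> L2_space. AE x in lborel. f x = 0} \<and>
     L2_closure (\<Union>j. V j) = L2_space \<and>
     (\<forall>f\<in>L2_space. \<forall>j. f \<in> V j \<longleftrightarrow> (\<lambda>x. f (2 *\<^sub>R x)) \<in> V (j + 1)) \<and>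
     (\<forall>f\<in>L2_space. \<forall>k. f \<in> V 0 \<longleftrightarrow> (\<lambda>x. f (x - lattice_vec k)) \<in> V 0) \<and>
     \<phi> \<in> V 0 \<and> has_bochner_integral lborel \<phi> 1 \<and>
     (\<forall>j. orthonormal_hilbert_basis (\<lambda>k. dilate \<phi> j k) UNIV (V j))"

definition detail_space ::
    "(int \<Rightarrow> (real ^ 'n \<Rightarrow> complex) set) \<Rightarrow> int \<Rightarrow> (real ^ 'n \<Rightarrow> complex) set" where
  "detail_space V j = {f \<in> V (j + 1). \<forall>g\<in>V j. L2_inner f g = 0}"

definition orthonormal_wavelet_system ::
    "(real ^ 'n \<Rightarrow> complex) \<Rightarrow> 'e set \<Rightarrow> ('e \<Rightarrow> real ^ 'n \<Rightarrow> complex) \<Rightarrow> bool" where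
  "orthonormal_wavelet_system \<phi> \<alpha> \<psi> \<longleftrightarrow>
     finite \<alpha> \<and>
     (\<exists>V. multiresolution_approximation V \<phi> \<and>
       (\<forall>\<epsilon>\<in>\<alpha>. \<psi> \<epsilon> \<in> detail_space V 0 \<and> has_bochner_integral lborel (\<psi> \<epsilon>) 0) \<and>
       (\<forall>j. orthonormal_hilbert_basis (\<lambda>(\<epsilon>, k). dilate (\<psi> \<epsilon>) j k) (\<alpha> \<times> UNIV) (detail_space V j)))"

definition partial_deriv :: "'n \<Rightarrow> (real ^ 'n \<Rightarrow> complex) \<Rightarrow> real ^ 'n \<Rightarrow> complex" where
  "partial_deriv i f x = frechet_derivative f (at x) (axis i 1)"

definition iter_partial_deriv :: "'n list \<Rightarrow> (real ^ 'n \<Rightarrow> complex) \<Rightarrow> real ^ 'n \<Rightarrow> complex" where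
  "iter_partial_deriv is f = foldr partial_deriv is f"

definition continuously_differentiable_upto :: "nat \<Rightarrow> (real ^ 'n \<Rightarrow> complex) \<Rightarrow> bool" where
  "continuously_differentiable_upto r f \<longleftrightarrow>
     (\<forall>is. length is < r \<longrightarrow> (\<forall>x. iter_partial_deriv is f differentiable at x)) \<and>
     (\<forall>is. length is \<le> r \<longrightarrow> continuous_on UNIV (iter_partial_deriv is f))"

definition rapidly_decaying :: "(real ^ 'n \<Rightarrow> complex) \<Rightarrow> bool" where
  "rapidly_decaying f \<longleftrightarrow> (\<forall>m::nat. \<exists>C. \<forall>x. (1 + norm x) ^ m * cmod (f x) \<le> C)"

definition regular_function :: "nat \<Rightarrow> (real ^ 'n \<Rightarrow> complex) \<Rightarrow> bool" where
  "regular_function r f \<longleftrightarrow> continuously_differentiable_upto r f \<and>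
     (\<forall>is. length is \<le> r \<longrightarrow> rapidly_decaying (iter_partial_deriv is f))"

definition regular_wavelet_system ::
    "nat \<Rightarrow> (real ^ 'n \<Rightarrow> complex) \<Rightarrow> 'e set \<Rightarrow> ('e \<Rightarrow> real ^ 'n \<Rightarrow> complex) \<Rightarrow> bool" where
  "regular_wavelet_system r \<phi> \<alpha> \<psi> \<longleftrightarrow>
     regular_function r \<phi> \<and> (\<forall>\<epsilon>\<in>\<alpha>. regular_function r (\<psi> \<epsilon>))"

definition compactly_supported :: "(real ^ 'n \<Rightarrow> complex) \<Rightarrow> bool" where
  "compactly_supported f \<longleftrightarrow> compact (closure {x. f x \<noteq> 0})"

definition compactly_supported_wavelet_system ::
    "(real ^ 'n \<Rightarrow> complex) \<Rightarrow> 'e set \<Rightarrow> ('e \<Rightarrow> real ^ 'n \<Rightarrow> complex) \<Rightarrow> bool" where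
  "compactly_supported_wavelet_system \<phi> \<alpha> \<psi> \<longleftrightarrow>
     compactly_supported \<phi> \<and> (\<forall>\<epsilon>\<in>\<alpha>. compactly_supported (\<psi> \<epsilon>))"

definition detail_coeff ::
    "(real ^ 'n \<Rightarrow> complex) \<Rightarrow> (real ^ 'n \<Rightarrow> complex) \<Rightarrow> int \<Rightarrow> int ^ 'n \<Rightarrow> complex" where
  "detail_coeff \<psi>\<^sub>\<epsilon> f j k = (\<integral>x. f x * cnj (dilate \<psi>\<^sub>\<epsilon> j k x) \<partial>lborel)"

definition holder :: "real \<Rightarrow> (real ^ 'n \<Rightarrow> complex) \<Rightarrow> bool" where
  "holder s f \<longleftrightarrow> (\<exists>C. \<forall>x y. cmod (f x - f y) \<le> C * norm (x - y) powr s)"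

text \<open>Suprema below are taken in the reals; the seminorm is only meaningful together with
  \<open>holder\<close>, which makes its supremum bounded.\<close>

definition holder_seminorm :: "real \<Rightarrow> (real ^ 'n \<Rightarrow> complex) \<Rightarrow> real" where
  "holder_seminorm s f = Sup {cmod (f x - f y) / norm (x - y) powr s | x y. x \<noteq> y}"

definition holder_dual_norm :: "real \<Rightarrow> (real ^ 'n \<Rightarrow> complex) \<Rightarrow> real" where
  "holder_dual_norm s g =
     Sup {cmod (\<integral>x. f x * g x \<partial>lborel) | f. holder s f \<and> holder_seminorm s f \<le> 1}"

text \<open>The test functions are complex valued. For real-valued \<open>g\<close> real test functions give the
  same supremum. If \<open>g\<close> is not a constant multiple of a real function, they give a strictly
  smaller one, which already suffices for the transport lower bound because densities are
  real; so tightness of the constant below is a statement about real-valued wavelet functions.\<close>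

definition E_const :: "'e set \<Rightarrow> ('e \<Rightarrow> real ^ 'n \<Rightarrow> complex) \<Rightarrow> real \<Rightarrow> real" where
  "E_const \<alpha> \<psi> s = 1 / Max ((\<lambda>\<epsilon>. holder_dual_norm s (\<psi> \<epsilon>)) ` \<alpha>)"

definition lebesgue_density :: "(real ^ 'n) measure \<Rightarrow> real ^ 'n \<Rightarrow> real" where
  "lebesgue_density \<mu> x = enn2real (RN_deriv lborel \<mu> x)"

text \<open>Measures on \<open>K\<close> are Borel measures on the whole space for which the complement of \<open>K\<close> is null.\<close>

definition P_ab2 :: "(real ^ 'n) set \<Rightarrow> (real ^ 'n) measure set" where
  "P_ab2 K = {\<mu>. prob_space \<mu> \<and> sets \<mu> = sets borel \<and> emeasure \<mu> (- K) = 0 \<and>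
     absolutely_continuous lborel \<mu> \<and> integrable lborel (\<lambda>x. (lebesgue_density \<mu> x)\<^sup>2)}"

definition couplings ::
    "(real ^ 'n) measure \<Rightarrow> (real ^ 'n) measure \<Rightarrow> ((real ^ 'n) \<times> (real ^ 'n)) measure set" where
  "couplings \<mu> \<nu> = {\<gamma>. prob_space \<gamma> \<and> sets \<gamma> = sets borel \<and>
     distr \<gamma> borel fst = \<mu> \<and> distr \<gamma> borel snd = \<nu>}"

definition wasserstein :: "real \<Rightarrow> (real ^ 'n) measure \<Rightarrow> (real ^ 'n) measure \<Rightarrow> real" where
  "wasserstein s \<mu> \<nu> =
     enn2real (INF \<gamma>\<in>couplings \<mu> \<nu>. \<integral>\<^sup>+(x, y). ennreal (norm (x - y) powr s) \<partial>\<gamma>)"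

text \<open>The family below is summable for compactly supported wavelets and measures in \<open>P_ab2 K\<close>
  with \<open>K\<close> compact and \<open>s > 0\<close>: at scale \<open>j \<ge> j\<^sub>0\<close> only \<open>O(2\<^sup>n\<^sup>j)\<close> coefficients are nonzero, and by the
  Cauchy-Schwarz inequality their contribution is \<open>O(2\<^sup>-\<^sup>s\<^sup>j)\<close>.\<close>

definition wavelet_distance ::
    "'e set \<Rightarrow> ('e \<Rightarrow> real ^ 'n \<Rightarrow> complex) \<Rightarrow> int \<Rightarrow> real \<Rightarrow>
     (real ^ 'n) measure \<Rightarrow> (real ^ 'n) measure \<Rightarrow> real" where
  "wavelet_distance \<alpha> \<psi> j\<^sub>0 s \<mu> \<nu> =
     (\<Sum>\<^sub>\<infinity>(\<epsilon>, j, k)\<in>\<alpha> \<times> {j\<^sub>0..} \<times> UNIV.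
        2 powr (- of_int j * (s + real CARD('n) / 2)) *
        cmod (detail_coeff (\<psi> \<epsilon>)
          (\<lambda>x. of_real (lebesgue_density \<mu> x - lebesgue_density \<nu> x)) j k))"

end

theory Submission
  imports Defs
begin

text \<open>
  A pair of measures whose densities differ by a multiple of a single wavelet already shows that
  the constant is tight. Choose a ball in \<open>K\<close> and a scale \<open>j\<close> so fine that some
  \<open>\<psi>\<^bsub>(\<epsilon>,(j,k))\<^esub>\<close> lives in that ball. Let \<open>\<nu>\<close> be the uniform distribution on the ball and let \<open>\<mu>\<close> have
  density \<open>p\<^sub>\<nu> + c \<psi>\<^bsub>(\<epsilon>,(j,k))\<^esub>\<close> with \<open>c > 0\<close> small enough to keep it nonnegative; its mass
  stays \<open>1\<close> because wavelets have mean zero (\<open>exists_test_densities\<close>). Two estimates face each other.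

  \<^item> By orthonormality across all indices, \<open>p\<^sub>\<mu> - p\<^sub>\<nu>\<close> has exactly one nonzero detail coefficient, so
    whatever the cutoff \<open>j\<^sub>0\<close>, the wavelet distance is at most \<open>w = 2 powr (- j (s + n/2)) c\<close>
    (\<open>wavelet_distance_single\<close>).

  \<^item> For \<open>F\<close> of Hoelder seminorm at most \<open>1\<close>, the rescaled function \<open>2 powr (- j s) F(2 powi j x - k)\<close>
    again has seminorm at most \<open>1\<close>, and pairing it with \<open>p\<^sub>\<mu> - p\<^sub>\<nu>\<close> gives \<open>w \<integral> F \<psi>\<^sub>\<epsilon>\<close>. The easy half of
    Kantorovich duality (\<open>wasserstein_ge\<close>) therefore yields
    \<open>W\<^sub>s(\<mu>, \<nu>) \<ge> w \<bar>\<integral> F \<psi>\<^sub>\<epsilon>\<bar>\<close>.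

  The pair does not depend on \<open>\<eta>\<close>, so letting \<open>\<eta>\<close> tend to \<open>0\<close> in the assumed bound gives
  \<open>C w \<bar>\<integral> F \<psi>\<^sub>\<epsilon>\<bar> \<le> w\<close>, that is \<open>C \<bar>\<integral> F \<psi>\<^sub>\<epsilon>\<bar> \<le> 1\<close> (\<open>Holder_pairing_bound\<close>). Taking the supremum over
  \<open>F\<close> bounds every dual norm by \<open>1/C\<close>.

  Two degenerate readings of \<open>E_const\<close> have to be excluded before this says \<open>C \<le> E_const \<alpha> \<psi> s\<close>.
  The maximum is over a nonempty set: without wavelets the spaces \<open>V\<^sub>j\<close> would all coincide and \<open>\<phi>\<close>
  would lie in their intersection, hence vanish almost everywhere (\<open>wavelet_index_nonempty\<close>). And the
  dual norms are positive: \<open>\<psi>\<^sub>\<epsilon>\<close> is itself Hoelder continuous and \<open>\<integral> \<psi>\<^sub>\<epsilon>\<^sup>2 = 1\<close>.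
\<close>

section \<open>Dilates and translates\<close>

lemma integrable_bounded_support:
  fixes f :: "'a::euclidean_space \<Rightarrow> 'b::{banach, second_countable_topology}"
  assumes [measurable]: "f \<in> borel_measurable borel"
    and bound: "\<And>x. norm (f x) \<le> M" and supp: "\<And>x. f x \<noteq> 0 \<Longrightarrow> norm x \<le> R"
  shows "integrable lborel f"
proof (rule Bochner_Integration.integrable_bound)
  show "integrable lborel (\<lambda>x::'a. indicator (cball 0 R) x *\<^sub>R M)"
    by (intro integrable_scaleR_left integrable_real_indicator)
       (use emeasure_bounded_finite[OF bounded_cball, of "0::'a" R] in auto)
  have "norm (f x) \<le> norm (indicator (cball 0 R) x *\<^sub>R M)" for x
    using bound[of x] supp[of x] norm_ge_zero[of "f x"]
    by (cases "f x = 0") (auto simp: indicator_def simp del: norm_ge_zero)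
  then show "AE x in lborel. norm (f x) \<le> norm (indicator (cball 0 R) x *\<^sub>R M)" by simp
qed simp

lemma integral_lborel_affine:
  fixes g :: "'a::euclidean_space \<Rightarrow> 'b::{banach, second_countable_topology}"
  assumes [measurable]: "g \<in> borel_measurable borel" and c: "c \<noteq> 0"
  shows "integral\<^sup>L lborel g = \<bar>c\<bar> ^ DIM('a) *\<^sub>R (\<integral>x. g (t + c *\<^sub>R x) \<partial>lborel)"
proof -
  have "integral\<^sup>L lborel g
      = integral\<^sup>L (density (distr lborel borel (\<lambda>x. t + c *\<^sub>R x)) (\<lambda>_. ennreal (\<bar>c\<bar> ^ DIM('a)))) g"
    using lborel_affine[OF c, of t] by (simp add: ennreal_power)
  also have "\<dots> = (\<integral>x. \<bar>c\<bar> ^ DIM('a) *\<^sub>R g (t + c *\<^sub>R x) \<partial>lborel)"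
    by (subst integral_density) (simp_all add: integral_distr)
  finally show ?thesis by simp
qed

lemma scaled_lattice_shift_measurable [measurable]:
  "(\<lambda>x. (2 powi j) *\<^sub>R x - lattice_vec k) \<in> borel_measurable borel"
  by simp

lemma dilate_measurable [measurable]:
  "f \<in> borel_measurable borel \<Longrightarrow> dilate f j k \<in> borel_measurable borel"
  unfolding dilate_def [abs_def]
  by (intro borel_measurable_times borel_measurable_const
      measurable_compose[OF scaled_lattice_shift_measurable])

lemma dilate_support:
  fixes f :: "real ^ 'n \<Rightarrow> complex"
  assumes "\<And>x. f x \<noteq> 0 \<Longrightarrow> norm x \<le> R" and "dilate f j k x \<noteq> 0"
  shows "norm ((2 powi j) *\<^sub>R x - lattice_vec k) \<le> R"
  using assms(2) by (intro assms(1)) (auto simp: dilate_def)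

lemma dilate_bound:
  fixes f :: "real ^ 'n \<Rightarrow> complex"
  assumes "\<And>x. cmod (f x) \<le> M"
  shows "cmod (dilate f j k x) \<le> 2 powr (real CARD('n) * of_int j / 2) * M"
  unfolding dilate_def by (simp add: norm_mult assms mult_left_mono)

lemma dilate_support_norm:
  fixes f :: "real ^ 'n \<Rightarrow> complex"
  assumes "\<And>x. f x \<noteq> 0 \<Longrightarrow> norm x \<le> R" and "dilate f j k x \<noteq> 0"
  shows "norm x \<le> (R + norm (lattice_vec k :: real ^ 'n)) / 2 powi j"
proof -
  have "norm ((2 powi j :: real) *\<^sub>R x) \<le> R + norm (lattice_vec k :: real ^ 'n)"
    using dilate_support[OF assms] norm_triangle_sub[of "(2 powi j :: real) *\<^sub>R x" "lattice_vec k"]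
    by simp
  then show ?thesis by (simp add: field_simps)
qed

text \<open>
  The substitution \<open>y = 2 powi j x - k\<close>: the Jacobian \<open>2 powr (- n j)\<close> meets the normalising factor
  \<open>2 powr (n j / 2)\<close> of \<open>dilate\<close>.
\<close>

lemma integral_mult_dilate:
  fixes f F :: "real ^ 'n \<Rightarrow> complex"
  assumes [measurable]: "f \<in> borel_measurable borel" "F \<in> borel_measurable borel"
  shows "(\<integral>x. F ((2 powi j) *\<^sub>R x - lattice_vec k) * dilate f j k x \<partial>lborel)
       = of_real (2 powr (- (real CARD('n) * of_int j / 2))) * (\<integral>x. F x * f x \<partial>lborel)"
proof -
  let ?c = "1 / 2 powi j :: real" and ?n = "real CARD('n)"
  let ?t = "?c *\<^sub>R (lattice_vec k :: real ^ 'n)"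
  have inv: "(2 powi j) *\<^sub>R (?t + ?c *\<^sub>R x) - lattice_vec k = x" for x :: "real ^ 'n"
    by (simp add: algebra_simps)
  have "(\<integral>x. F ((2 powi j) *\<^sub>R x - lattice_vec k) * dilate f j k x \<partial>lborel)
      = \<bar>?c\<bar> ^ CARD('n) *\<^sub>R (\<integral>x. F x * (of_real (2 powr (?n * of_int j / 2)) * f x) \<partial>lborel)"
    by (subst integral_lborel_affine[where c = ?c and t = ?t])
       (simp_all only: dilate_def inv, simp_all)
  also have "(\<integral>x. F x * (of_real (2 powr (?n * of_int j / 2)) * f x) \<partial>lborel)
      = of_real (2 powr (?n * of_int j / 2)) * (\<integral>x. F x * f x \<partial>lborel)"
    by (subst integral_mult_right_zero[symmetric]) (simp add: mult_ac)
  also have "\<bar>?c\<bar> ^ CARD('n) = 2 powr (- (?n * of_int j))"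
    by (simp add: powr_minus powr_real_of_int' powr_powr[symmetric] mult.commute powr_realpow
        power_divide field_simps flip: powr_realpow)
  also have "2 powr (- (?n * of_int j)) *\<^sub>R
      (of_real (2 powr (?n * of_int j / 2)) * (\<integral>x. F x * f x \<partial>lborel))
      = of_real (2 powr (- (?n * of_int j)) * 2 powr (?n * of_int j / 2)) * (\<integral>x. F x * f x \<partial>lborel)"
    by (simp add: scaleR_conv_of_real)
  also have "2 powr (- (?n * of_int j)) * 2 powr (?n * of_int j / 2)
      = (2::real) powr (- (?n * of_int j / 2))"
    by (subst powr_add[symmetric]) (simp add: mult.commute)
  finally show ?thesis .
qed

section \<open>The inner product and closed subspaces\<close>

lemma L2_product_integrable:
  fixes f g :: "real ^ 'n \<Rightarrow> complex"
  assumes "f \<in> L2_space" "g \<in> L2_space"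
  shows "integrable lborel (\<lambda>x. f x * cnj (g x))"
proof (rule Bochner_Integration.integrable_bound)
  show "integrable lborel (\<lambda>x. (cmod (f x))\<^sup>2 + (cmod (g x))\<^sup>2)"
    using assms by (simp add: L2_space_def)
  show "(\<lambda>x. f x * cnj (g x)) \<in> borel_measurable lborel"
    using assms by (auto simp: L2_space_def
        intro!: borel_measurable_times measurable_compose[OF _ borel_measurable_continuous_onI[OF continuous_on_cnj[OF continuous_on_id]]])
  have "cmod (f x) * cmod (g x) \<le> (cmod (f x))\<^sup>2 + (cmod (g x))\<^sup>2" for x
    using sum_squares_bound[of "cmod (f x)" "cmod (g x)"]
      mult_nonneg_nonneg[OF norm_ge_zero norm_ge_zero, of "f x" "g x"] by linarith
  then show "AE x in lborel. norm (f x * cnj (g x)) \<le> norm ((cmod (f x))\<^sup>2 + (cmod (g x))\<^sup>2)"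
    by (simp add: norm_mult)
qed

text \<open>
  The Cauchy--Schwarz inequality in its additive form, with a free weight \<open>t\<close> in place of the
  optimal one, so that vanishing norms are covered as well.
\<close>

lemma L2_inner_bound:
  fixes f g :: "real ^ 'n \<Rightarrow> complex"
  assumes f: "f \<in> L2_space" and g: "g \<in> L2_space" and t: "t > 0"
  shows "cmod (L2_inner f g) \<le> t * (L2_norm f)\<^sup>2 + (L2_norm g)\<^sup>2 / t"
proof -
  have sq: "(L2_norm h)\<^sup>2 = (\<integral>x. (cmod (h x))\<^sup>2 \<partial>lborel)" for h :: "real ^ 'n \<Rightarrow> complex"
    by (simp add: L2_norm_def)
  have [simp]: "integrable lborel (\<lambda>x. (cmod (f x))\<^sup>2)" "integrable lborel (\<lambda>x. (cmod (g x))\<^sup>2)"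
    using f g by (simp_all add: L2_space_def)
  have "cmod (L2_inner f g) \<le> (\<integral>x. t * (cmod (f x))\<^sup>2 + (cmod (g x))\<^sup>2 / t \<partial>lborel)"
    unfolding L2_inner_def
  proof (rule order_trans[OF integral_norm_bound integral_mono])
    show "integrable lborel (\<lambda>x. cmod (f x * cnj (g x)))"
      by (intro integrable_norm L2_product_integrable f g)
    fix x
    have "0 \<le> (sqrt t * cmod (f x) - cmod (g x) / sqrt t)\<^sup>2" by simp
    then have "2 * (cmod (f x) * cmod (g x)) \<le> t * (cmod (f x))\<^sup>2 + (cmod (g x))\<^sup>2 / t"
      using t by (simp add: power2_diff power_mult_distrib power_divide)
    moreover have "0 \<le> cmod (f x) * cmod (g x)" by simp
    ultimately show "cmod (f x * cnj (g x)) \<le> t * (cmod (f x))\<^sup>2 + (cmod (g x))\<^sup>2 / t"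
      unfolding norm_mult complex_mod_cnj by linarith
  qed simp
  also have "\<dots> = t * (L2_norm f)\<^sup>2 + (L2_norm g)\<^sup>2 / t"
    by (simp add: sq)
  finally show ?thesis .
qed

lemma L2_inner_cnj: "L2_inner f g = cnj (L2_inner g f)"
proof -
  have "cnj (L2_inner g f) = (\<integral>x. cnj (g x * cnj (f x)) \<partial>lborel)"
    unfolding L2_inner_def by (rule Bochner_Integration.integral_cnj[symmetric])
  then show ?thesis by (simp add: L2_inner_def mult.commute)
qed

lemma L2_inner_diff_right:
  assumes "f \<in> L2_space" "g \<in> L2_space" "h \<in> L2_space"
  shows "L2_inner f (\<lambda>x. g x - h x) = L2_inner f g - L2_inner f h"
  unfolding L2_inner_def using assms
  by (simp add: right_diff_distrib L2_product_integrable)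

lemma L2_inner_diff_left:
  assumes "f \<in> L2_space" "g \<in> L2_space" "h \<in> L2_space"
  shows "L2_inner (\<lambda>x. f x - g x) h = L2_inner f h - L2_inner g h"
  unfolding L2_inner_def using assms
  by (simp add: left_diff_distrib L2_product_integrable)

lemma L2_inner_sum_left:
  assumes "\<And>i. i \<in> F \<Longrightarrow> b i \<in> L2_space" "h \<in> L2_space"
  shows "L2_inner (\<lambda>x. \<Sum>i\<in>F. c i * b i x) h = (\<Sum>i\<in>F. c i * L2_inner (b i) h)"
  unfolding L2_inner_def using assms
  by (simp add: sum_distrib_right mult.assoc L2_product_integrable)

lemma closed_L2_subspace_add:
  "closed_L2_subspace V \<Longrightarrow> f \<in> V \<Longrightarrow> g \<in> V \<Longrightarrow> (\<lambda>x. f x + g x) \<in> V"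
  by (simp add: closed_L2_subspace_def)

lemma closed_L2_subspace_scale:
  "closed_L2_subspace V \<Longrightarrow> f \<in> V \<Longrightarrow> (\<lambda>x. c * f x) \<in> V"
  by (simp add: closed_L2_subspace_def)

lemma closed_L2_subspace_sum:
  assumes V: "closed_L2_subspace V" and "finite F" "\<And>i. i \<in> F \<Longrightarrow> b i \<in> V"
  shows "(\<lambda>x. \<Sum>i\<in>F. c i * b i x) \<in> V"
  using assms(2,3)
proof (induction F)
  case empty
  then show ?case using V by (simp add: closed_L2_subspace_def)
next
  case (insert a F)
  have "(\<lambda>x. c a * b a x + (\<Sum>i\<in>F. c i * b i x)) \<in> V"
    using insert by (intro closed_L2_subspace_add closed_L2_subspace_scale V) auto
  then show ?case using insert by simp
qed

lemma closed_L2_subspace_diff: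
  assumes V: "closed_L2_subspace V" and "f \<in> V" "g \<in> V"
  shows "(\<lambda>x. f x - g x) \<in> V"
  using closed_L2_subspace_add[OF V _ closed_L2_subspace_scale[OF V, of g "-1"]] assms by simp

lemma basis_mem: "orthonormal_hilbert_basis b I V \<Longrightarrow> i \<in> I \<Longrightarrow> b i \<in> V"
  unfolding orthonormal_hilbert_basis_def by (elim conjE) (erule (1) bspec)

lemma basis_inner:
  "orthonormal_hilbert_basis b I V \<Longrightarrow> i \<in> I \<Longrightarrow> j \<in> I
    \<Longrightarrow> L2_inner (b i) (b j) = (if i = j then 1 else 0)"
  by (simp add: orthonormal_hilbert_basis_def)

text \<open>
  Orthogonality passes from the basis to its closed span by approximation. The weight \<open>t\<close> in
  \<open>L2_inner_bound\<close> is first chosen so small that the term with the norm of \<open>h\<close> takes at most half of \<open>\<bar>\<langle>h, g\<rangle>\<bar>\<close>;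
  the approximation of \<open>g\<close> is then taken so close that the other term stays strictly below the remaining half.
\<close>

lemma L2_inner_zero_basis:
  assumes V: "closed_L2_subspace V" and basis: "orthonormal_hilbert_basis b I V"
    and h: "h \<in> L2_space" and orth: "\<And>i. i \<in> I \<Longrightarrow> L2_inner h (b i) = 0"
    and g: "g \<in> V"
  shows "L2_inner h g = 0"
proof (rule ccontr)
  let ?N = "L2_norm h"
  assume "L2_inner h g \<noteq> 0"
  then have pos: "0 < cmod (L2_inner h g)" (is "0 < ?a") by simp
  define t where "t = ?a / 2 / (?N\<^sup>2 + 1)"
  have N: "0 < ?N\<^sup>2 + 1" by (simp add: add_nonneg_pos)
  have t: "0 < t" using pos N by (simp add: t_def)
  have tN: "t * ?N\<^sup>2 \<le> ?a / 2"
  proof -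
    have "t * ?N\<^sup>2 \<le> t * (?N\<^sup>2 + 1)" using t by simp
    also have "\<dots> = ?a / 2"
      unfolding t_def by (rule nonzero_eq_divide_eq[THEN iffD1, OF _ refl]) (use N in linarith)
    finally show ?thesis .
  qed
  define e where "e = sqrt (?a * t / 2)"
  have e: "0 < e" using pos t by (simp add: e_def)
  then obtain F c where F: "finite F" "F \<subseteq> I"
    and close: "L2_norm (\<lambda>x. g x - (\<Sum>i\<in>F. c i * b i x)) < e"
    using g basis unfolding orthonormal_hilbert_basis_def L2_closure_def by blast
  let ?p = "\<lambda>x. \<Sum>i\<in>F. c i * b i x"
  have VL: "V \<subseteq> L2_space" using V by (simp add: closed_L2_subspace_def)
  have b: "b i \<in> V" if "i \<in> F" for i
    using basis F that by (auto simp: orthonormal_hilbert_basis_def)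
  have p: "?p \<in> V" by (intro closed_L2_subspace_sum V F b)
  have "L2_inner ?p h = 0"
    using F h b VL orth L2_inner_cnj[of _ h] by (subst L2_inner_sum_left) (auto intro!: sum.neutral)
  then have "L2_inner h ?p = 0" using L2_inner_cnj[of h ?p] by simp
  then have "L2_inner h g = L2_inner h (\<lambda>x. g x - ?p x)"
    using VL g p by (subst L2_inner_diff_right) (auto simp: h)
  then have "?a \<le> t * ?N\<^sup>2 + (L2_norm (\<lambda>x. g x - ?p x))\<^sup>2 / t"
    using L2_inner_bound[OF h _ t] closed_L2_subspace_diff[OF V g p] VL by auto
  also have "(L2_norm (\<lambda>x. g x - ?p x))\<^sup>2 < e\<^sup>2"
    using close by (intro power_strict_mono) (simp_all add: L2_norm_def)
  also have "e\<^sup>2 = ?a * t / 2" using pos t by (simp add: e_def)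
  finally have "?a < t * ?N\<^sup>2 + ?a * t / 2 / t" using t by (simp add: divide_strict_right_mono)
  then show False using tN t by simp
qed

section \<open>There is at least one wavelet function\<close>

lemma finite_bounded_lattice:
  "finite {k :: int ^ 'n. norm (lattice_vec k :: real ^ 'n) \<le> B}"
proof (rule finite_subset)
  let ?S = "{- \<lceil>B\<rceil>..\<lceil>B\<rceil>}"
  show "{k :: int ^ 'n. norm (lattice_vec k :: real ^ 'n) \<le> B}
      \<subseteq> vec_lambda ` (PiE UNIV (\<lambda>_. ?S))"
  proof
    fix k :: "int ^ 'n"
    assume "k \<in> {k. norm (lattice_vec k :: real ^ 'n) \<le> B}"
    then have k: "norm (lattice_vec k :: real ^ 'n) \<le> B" by simp
    have "\<bar>real_of_int (k $ i)\<bar> \<le> B" for i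
      using component_le_norm_cart[of "lattice_vec k :: real ^ 'n" i] k
      by (simp add: lattice_vec_def)
    then have "k $ i \<in> ?S" for i
      by (metis abs_le_iff atLeastAtMost_iff ceiling_mono ceiling_of_int minus_le_iff of_int_minus)
    then show "k \<in> vec_lambda ` (PiE UNIV (\<lambda>_. ?S))"
      by (intro image_eqI[of _ _ "vec_nth k"]) auto
  qed
  show "finite (vec_lambda ` (PiE (UNIV :: 'n set) (\<lambda>_. ?S)))"
    by (intro finite_imageI finite_PiE) auto
qed

lemma L2_closure_mono: "S \<subseteq> T \<Longrightarrow> L2_closure S \<subseteq> L2_closure T"
  unfolding L2_closure_def by blast

text \<open>
  Functions with bounded support have finite expansions: only finitely many translates at scale
  \<open>j\<close> meet the support of a given dilate. The orthogonal projection of that dilate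
  onto the coarser space is therefore a finite sum.
\<close>

lemma finite_overlapping_translates:
  fixes \<phi> :: "real ^ 'n \<Rightarrow> complex"
  assumes supp: "\<And>x. \<phi> x \<noteq> 0 \<Longrightarrow> norm x \<le> R"
  shows "finite {l. L2_inner (dilate \<phi> i k) (dilate \<phi> j l) \<noteq> 0}"
proof (rule finite_subset[OF _ finite_bounded_lattice])
  let ?B = "(2::real) powi j * ((R + norm (lattice_vec k :: real ^ 'n)) / 2 powi i) + R"
  show "{l. L2_inner (dilate \<phi> i k) (dilate \<phi> j l) \<noteq> 0}
      \<subseteq> {l. norm (lattice_vec l :: real ^ 'n) \<le> ?B}"
  proof safe
    fix l
    assume "L2_inner (dilate \<phi> i k) (dilate \<phi> j l) \<noteq> 0"
    then have "\<exists>x. dilate \<phi> i k x * cnj (dilate \<phi> j l x) \<noteq> 0"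
      by (rule contrapos_np) (auto simp: L2_inner_def intro!: integral_eq_zero_AE)
    then obtain x where x: "dilate \<phi> i k x \<noteq> 0" "dilate \<phi> j l x \<noteq> 0" by auto
    let ?y = "(2 powi j :: real) *\<^sub>R x"
    have "norm (lattice_vec l :: real ^ 'n) \<le> norm ?y + norm (?y - lattice_vec l)"
      using norm_triangle_ineq4[of ?y "?y - lattice_vec l"] by simp
    also have "norm (?y - lattice_vec l) \<le> R"
      by (rule dilate_support[OF supp x(2)])
    also have "norm ?y \<le> 2 powi j * ((R + norm (lattice_vec k :: real ^ 'n)) / 2 powi i)"
      unfolding norm_scaleR
      by (intro mult_mono dilate_support_norm[OF supp x(1)]) simp_all
    finally show "norm (lattice_vec l :: real ^ 'n) \<le> ?B" by simp
  qed
qed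

text \<open>
  The remainder \<open>h\<close> of a basis element of \<open>V\<^bsub>j+1\<^esub>\<close> after projection onto \<open>V\<^sub>j\<close> lies in the detail space.
  If that space contains only null functions, every basis element of \<open>V\<^bsub>j+1\<^esub>\<close> agrees almost everywhere
  with an element of \<open>V\<^sub>j\<close>.
\<close>

lemma trivial_detail_space_imp_subset:
  fixes \<phi> :: "real ^ 'n \<Rightarrow> complex"
  assumes mra: "multiresolution_approximation V \<phi>"
    and supp: "\<And>x. \<phi> x \<noteq> 0 \<Longrightarrow> norm x \<le> R"
    and trivial: "\<And>h. h \<in> detail_space V j \<Longrightarrow> L2_norm h = 0"
  shows "V (j + 1) \<subseteq> V j"
proof -
  have sub: "closed_L2_subspace (V i)" and basis: "orthonormal_hilbert_basis (dilate \<phi> i) UNIV (V i)" for i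
    using mra by (auto simp: multiresolution_approximation_def)
  have mono: "V j \<subseteq> V (j + 1)"
    using mra by (auto simp: multiresolution_approximation_def mono_def)
  have VL: "V i \<subseteq> L2_space" for i using sub by (simp add: closed_L2_subspace_def)
  have bV: "dilate \<phi> i k \<in> V i" and orth: "L2_inner (dilate \<phi> i k) (dilate \<phi> i l) = (if k = l then 1 else 0)"
    for i k l using basis_mem[OF basis] basis_inner[OF basis] by auto
  have bL: "dilate \<phi> i k \<in> L2_space" for i k using bV VL by blast
  have "dilate \<phi> (j + 1) k \<in> V j" for k
  proof -
    let ?c = "\<lambda>l. L2_inner (dilate \<phi> (j + 1) k) (dilate \<phi> j l)"
    define F where "F = {l. ?c l \<noteq> 0}"
    have F: "finite F" unfolding F_def by (rule finite_overlapping_translates[OF supp])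
    let ?p = "\<lambda>x. \<Sum>l\<in>F. ?c l * dilate \<phi> j l x"
    let ?h = "\<lambda>x. dilate \<phi> (j + 1) k x - ?p x"
    have p: "?p \<in> V j" by (intro closed_L2_subspace_sum sub F bV)
    have h: "?h \<in> V (j + 1)" using p mono by (intro closed_L2_subspace_diff sub bV) blast
    have h0: "L2_inner ?h (dilate \<phi> j l) = 0" for l
    proof -
      have "L2_inner ?h (dilate \<phi> j l) = ?c l - (\<Sum>m\<in>F. ?c m * L2_inner (dilate \<phi> j m) (dilate \<phi> j l))"
        using p VL by (subst L2_inner_diff_left, (auto simp: bL)[3], subst L2_inner_sum_left)
          (auto simp: bL)
      also have "(\<Sum>m\<in>F. ?c m * L2_inner (dilate \<phi> j m) (dilate \<phi> j l)) = (\<Sum>m\<in>F. if m = l then ?c m else 0)"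
        by (intro sum.cong) (auto simp: orth)
      also have "\<dots> = ?c l" using F by (simp add: F_def)
      finally show ?thesis by simp
    qed
    have "L2_inner ?h g = 0" if "g \<in> V j" for g
      by (rule L2_inner_zero_basis[OF sub basis subsetD[OF VL h] h0 that])
    then have "?h \<in> detail_space V j" using h by (simp add: detail_space_def)
    then have "L2_norm ?h = 0" by (rule trivial)
    then have "dilate \<phi> (j + 1) k \<in> L2_closure (V j)"
      unfolding L2_closure_def mem_Collect_eq
      using p by (intro conjI bL allI impI bexI[of _ ?p]) simp_all
    then show ?thesis using sub by (simp add: closed_L2_subspace_def)
  qed
  then have "{(\<lambda>x. \<Sum>k\<in>F. c k * dilate \<phi> (j + 1) k x) | F c. finite F \<and> F \<subseteq> UNIV} \<subseteq> V j"
    by (safe intro!: closed_L2_subspace_sum[OF sub])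
  from L2_closure_mono[OF this] show ?thesis
    using basis[of "j + 1"] sub[of j] by (simp add: orthonormal_hilbert_basis_def closed_L2_subspace_def)
qed

text \<open>
  Without wavelets every detail space is the closed span of the empty family, so the spaces \<open>V\<^sub>j\<close> are
  constant in \<open>j\<close>; then \<open>\<phi>\<close> lies in their intersection, which contradicts its integral being \<open>1\<close>.
\<close>

lemma wavelet_index_nonempty:
  fixes \<phi> :: "real ^ 'n \<Rightarrow> complex"
  assumes sys: "orthonormal_wavelet_system \<phi> \<alpha> \<psi>"
    and supp: "\<And>x. \<phi> x \<noteq> 0 \<Longrightarrow> norm x \<le> R"
  shows "\<alpha> \<noteq> {}"
proof
  assume "\<alpha> = {}"
  with sys obtain V where mra: "multiresolution_approximation V \<phi>"
    and basis: "\<And>j. orthonormal_hilbert_basis (\<lambda>(\<epsilon>, k). dilate (\<psi> \<epsilon>) j k) {} (detail_space V j)"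
    by (auto simp: orthonormal_wavelet_system_def)
  have "L2_norm h = 0" if "h \<in> detail_space V j" for h j
  proof -
    have "h \<in> L2_closure {\<lambda>x. 0}"
      using basis[of j] that unfolding orthonormal_hilbert_basis_def
      by (auto elim!: subsetD[OF L2_closure_mono, rotated])
    then have "\<not> 0 < L2_norm h" by (auto simp: L2_closure_def)
    moreover have "0 \<le> L2_norm h" by (simp add: L2_norm_def)
    ultimately show ?thesis by simp
  qed
  then have down: "V (j + 1) \<subseteq> V j" for j
    by (intro trivial_detail_space_imp_subset[OF mra supp])
  have \<phi>0: "\<phi> \<in> V 0" and "mono V" and V: "V 0 \<subseteq> L2_space"
    using mra by (auto simp: multiresolution_approximation_def closed_L2_subspace_def)
  have "\<phi> \<in> V j" for j
  proof (cases "0 \<le> j")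
    case True
    then show ?thesis using \<phi>0 \<open>mono V\<close> by (auto simp: mono_def)
  next
    case False
    then have "j \<le> 0" by simp
    then show ?thesis
    proof (induction rule: int_le_induct)
      case (step i)
      then show ?case using down[of "i - 1"] by auto
    qed (rule \<phi>0)
  qed
  then have "\<phi> \<in> (\<Inter>j. V j)" by blast
  moreover have "(\<Inter>j. V j) = {f \<in> L2_space. AE x in lborel. f x = 0}"
    and int: "has_bochner_integral lborel \<phi> 1"
    using mra by (auto simp: multiresolution_approximation_def)
  ultimately have "AE x in lborel. \<phi> x = 0" by auto
  then have "integral\<^sup>L lborel \<phi> = 0" by (rule integral_eq_zero_AE)
  then show False using int by (simp add: has_bochner_integral_integral_eq)
qed

section \<open>The wavelet distance of a one-wavelet perturbation\<close>

text \<open>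
  Within one scale orthonormality is part of the definition of a basis; across scales it follows
  from \<open>W\<^sub>j\<close> being orthogonal to \<open>V\<^sub>j\<close> together with \<open>W\<^bsub>j'\<^esub> \<subseteq> V\<^bsub>j'+1\<^esub> \<subseteq> V\<^sub>j\<close> for \<open>j' < j\<close>.
\<close>

lemma wavelet_orthonormal:
  assumes sys: "orthonormal_wavelet_system \<phi> \<alpha> \<psi>"
    and "\<epsilon> \<in> \<alpha>" "\<epsilon>' \<in> \<alpha>"
  shows "L2_inner (dilate (\<psi> \<epsilon>) j k) (dilate (\<psi> \<epsilon>') j' k')
       = (if (\<epsilon>, j, k) = (\<epsilon>', j', k') then 1 else 0)"
proof -
  obtain V where mra: "multiresolution_approximation V \<phi>"
    and basis: "\<And>j. orthonormal_hilbert_basis (\<lambda>(\<epsilon>, k). dilate (\<psi> \<epsilon>) j k) (\<alpha> \<times> UNIV) (detail_space V j)"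
    using sys by (auto simp: orthonormal_wavelet_system_def)
  have mono: "V i \<subseteq> V j" if "i \<le> j" for i j
    using mra that by (auto simp: multiresolution_approximation_def mono_def)
  have W: "dilate (\<psi> \<epsilon>) j k \<in> detail_space V j" if "\<epsilon> \<in> \<alpha>" for \<epsilon> j k
    using basis_mem[OF basis[of j], of "(\<epsilon>, k)"] that by simp
  have less: "L2_inner (dilate (\<psi> \<epsilon>) j k) (dilate (\<psi> \<epsilon>') j' k') = 0"
    if "\<epsilon> \<in> \<alpha>" "\<epsilon>' \<in> \<alpha>" "j' < j" for \<epsilon> \<epsilon>' j j' k k'
    using W[OF that(1), of j k] W[OF that(2), of j' k'] mono[of "j' + 1" j] that(3)
    by (auto simp: detail_space_def)
  consider "j' < j" | "j < j'" | "j' = j" by linarith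
  then show ?thesis
  proof cases
    case 1
    then show ?thesis using less assms by simp
  next
    case 2
    then have "L2_inner (dilate (\<psi> \<epsilon>') j' k') (dilate (\<psi> \<epsilon>) j k) = 0" using less assms by simp
    then show ?thesis using 2 L2_inner_cnj[of "dilate (\<psi> \<epsilon>) j k"] by simp
  next
    case 3
    from basis_inner[OF basis, of "(\<epsilon>, k)" "(\<epsilon>', k')" j]
    show ?thesis using 3 assms by simp
  qed
qed

lemma wavelet_distance_single:
  fixes \<psi> :: "'e \<Rightarrow> real ^ 'n \<Rightarrow> complex"
  assumes sys: "orthonormal_wavelet_system \<phi> \<alpha> \<psi>" and \<epsilon>: "\<epsilon> \<in> \<alpha>"
    and meas: "\<And>\<epsilon>. \<epsilon> \<in> \<alpha> \<Longrightarrow> \<psi> \<epsilon> \<in> borel_measurable borel"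
    and diff: "AE x in lborel. of_real (lebesgue_density \<mu> x - lebesgue_density \<nu> x)
                 = of_real c * dilate (\<psi> \<epsilon>) j k x"
    and c: "0 \<le> c"
  shows "wavelet_distance \<alpha> \<psi> j\<^sub>0 s \<mu> \<nu> \<le> 2 powr (- of_int j * (s + real CARD('n) / 2)) * c"
proof -
  let ?d = "\<lambda>x. complex_of_real (lebesgue_density \<mu> x - lebesgue_density \<nu> x)"
  let ?w = "\<lambda>j. 2 powr (- of_int j * (s + real CARD('n) / 2)) :: real"
  have coeff: "cmod (detail_coeff (\<psi> \<epsilon>') ?d j' k') = (if (\<epsilon>', j', k') = (\<epsilon>, j, k) then c else 0)"
    if "\<epsilon>' \<in> \<alpha>" for \<epsilon>' j' k'
  proof -
    have [measurable]: "(\<lambda>x. cnj (dilate (\<psi> \<epsilon>') j' k' x)) \<in> borel_measurable borel"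
      by (rule measurable_compose[OF dilate_measurable[OF meas[OF that]]
          borel_measurable_continuous_onI[OF continuous_on_cnj[OF continuous_on_id]]])
    have [measurable]: "lebesgue_density \<mu> \<in> borel_measurable borel"
        "lebesgue_density \<nu> \<in> borel_measurable borel"
      using borel_measurable_RN_deriv[of lborel] by (simp_all add: lebesgue_density_def [abs_def])
    have [measurable]: "dilate (\<psi> \<epsilon>) j k \<in> borel_measurable borel"
      using meas[OF \<epsilon>] by simp
    have "detail_coeff (\<psi> \<epsilon>') ?d j' k'
        = (\<integral>x. of_real c * (dilate (\<psi> \<epsilon>) j k x * cnj (dilate (\<psi> \<epsilon>') j' k' x)) \<partial>lborel)"
      unfolding detail_coeff_def
    proof (rule integral_cong_AE)
      show "AE x in lborel. ?d x * cnj (dilate (\<psi> \<epsilon>') j' k' x)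
          = of_real c * (dilate (\<psi> \<epsilon>) j k x * cnj (dilate (\<psi> \<epsilon>') j' k' x))"
        using diff by (elim eventually_mono) (simp only: mult.assoc)
    qed simp_all
    also have "\<dots> = of_real c * L2_inner (dilate (\<psi> \<epsilon>) j k) (dilate (\<psi> \<epsilon>') j' k')"
      by (simp add: L2_inner_def)
    finally show ?thesis
      using c by (auto simp: wavelet_orthonormal[OF sys \<epsilon> that])
  qed
  have "wavelet_distance \<alpha> \<psi> j\<^sub>0 s \<mu> \<nu>
      = (\<Sum>\<^sub>\<infinity>(\<epsilon>', j', k')\<in>(\<alpha> \<times> {j\<^sub>0..} \<times> UNIV) \<inter> {(\<epsilon>, j, k)}. ?w j' * c)"
    unfolding wavelet_distance_def
    by (rule infsum_cong_neutral) (auto simp: coeff simp del: of_real_diff split: if_splits)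
  also have "\<dots> \<le> ?w j * c"
    using c by (cases "(\<epsilon>, j, k) \<in> \<alpha> \<times> {j\<^sub>0..} \<times> (UNIV :: (int ^ 'n) set)") auto
  finally show ?thesis .
qed

section \<open>Hoelder functions\<close>

lemma rapidly_decaying_bounded:
  assumes "rapidly_decaying f"
  shows "\<exists>M. \<forall>x. cmod (f x) \<le> M"
proof -
  have "\<exists>M. \<forall>x. (1 + norm x) ^ 0 * cmod (f x) \<le> M"
    using assms unfolding rapidly_decaying_def by (rule spec)
  then show ?thesis by simp
qed

lemma regular_function_bounded:
  assumes "regular_function r f"
  shows "\<exists>M. \<forall>x. cmod (f x) \<le> M"
proof -
  have "rapidly_decaying (iter_partial_deriv [] f)"
    using assms unfolding regular_function_def by (metis le0 list.size(3))
  then show ?thesis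
    using rapidly_decaying_bounded by (auto simp: iter_partial_deriv_def)
qed

lemma regular_function_Lipschitz:
  fixes f :: "real ^ 'n \<Rightarrow> complex"
  assumes reg: "regular_function r f" and r: "1 \<le> r"
  shows "\<exists>L. \<forall>x y. cmod (f x - f y) \<le> L * norm (x - y)"
proof -
  let ?D = "\<lambda>x. frechet_derivative f (at x)"
  have "f differentiable at x" for x
    using reg r unfolding regular_function_def continuously_differentiable_upto_def
    by (auto dest!: spec[of _ "[]"] simp: iter_partial_deriv_def)
  then have D: "(f has_derivative ?D x) (at x)" for x
    by (simp add: frechet_derivative_works)
  have "\<exists>C. \<forall>x. cmod (?D x (axis i 1)) \<le> C" for i
  proof -
    have "rapidly_decaying (iter_partial_deriv [i] f)"
      using reg r by (auto simp: regular_function_def)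
    from rapidly_decaying_bounded[OF this] show ?thesis
      by (simp add: iter_partial_deriv_def partial_deriv_def)
  qed
  then obtain C where C: "\<And>i x. cmod (?D x (axis i 1)) \<le> C i" by metis
  have "onorm (?D x) \<le> (\<Sum>i\<in>UNIV. C i)" for x
  proof (rule onorm_le)
    fix v :: "real ^ 'n"
    have lin: "linear (?D x)" using D[of x] by (rule has_derivative_linear)
    have "?D x v = ?D x (\<Sum>i\<in>UNIV. v $ i *\<^sub>R axis i 1)"
      using basis_expansion[of v] by (simp add: scalar_mult_eq_scaleR)
    also have "\<dots> = (\<Sum>i\<in>UNIV. v $ i *\<^sub>R ?D x (axis i 1))"
      by (simp add: linear_sum[OF lin] linear_scale[OF lin])
    also have "cmod \<dots> \<le> (\<Sum>i\<in>UNIV. C i * norm v)"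
    proof (rule sum_norm_le)
      fix i
      show "cmod (v $ i *\<^sub>R ?D x (axis i 1)) \<le> C i * norm v"
        using mult_mono[OF component_le_norm_cart[of v i] C[of x i]]
        by (simp add: mult.commute)
    qed
    finally show "cmod (?D x v) \<le> (\<Sum>i\<in>UNIV. C i) * norm v" by (simp add: sum_distrib_right)
  qed
  then have "cmod (f x - f y) \<le> (\<Sum>i\<in>UNIV. C i) * norm (x - y)" for x y
    using D by (intro differentiable_bound[of UNIV]) auto
  then show ?thesis by blast
qed

text \<open>
  Lipschitz continuity controls small distances and boundedness controls large ones, because
  \<open>d \<le> d powr s\<close> for \<open>d \<le> 1\<close> and \<open>1 \<le> d powr s\<close> for \<open>d \<ge> 1\<close>.
\<close>

lemma regular_function_Holder:
  fixes f :: "real ^ 'n \<Rightarrow> complex"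
  assumes reg: "regular_function r f" "1 \<le> r" and s: "0 < s" "s < 1"
  shows "\<exists>B>0. \<forall>x y. cmod (f x - f y) \<le> B * norm (x - y) powr s"
proof -
  obtain M where M: "\<And>x. cmod (f x) \<le> M" using regular_function_bounded[OF reg(1)] by blast
  obtain L where L: "\<And>x y. cmod (f x - f y) \<le> L * norm (x - y)"
    using regular_function_Lipschitz[OF reg] by blast
  define B where "B = \<bar>L\<bar> + 2 * \<bar>M\<bar> + 1"
  have "cmod (f x - f y) \<le> B * norm (x - y) powr s" for x y
  proof (cases "norm (x - y) \<le> 1")
    case True
    have "norm (x - y) \<le> norm (x - y) powr s"
      using powr_mono'[of s 1 "norm (x - y)"] s True by simp
    have "cmod (f x - f y) \<le> L * norm (x - y)" by (rule L)
    also have "\<dots> \<le> B * norm (x - y)" by (intro mult_right_mono) (auto simp: B_def)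
    also have "\<dots> \<le> B * norm (x - y) powr s"
      by (intro mult_left_mono) (fact, simp add: B_def)
    finally show ?thesis .
  next
    case False
    have "cmod (f x - f y) \<le> B * 1"
      using norm_triangle_ineq4[of "f x" "f y"] M[of x] M[of y] by (simp add: B_def)
    also have "\<dots> \<le> B * norm (x - y) powr s"
      using False s by (intro mult_left_mono ge_one_powr_ge_zero) (auto simp: B_def)
    finally show ?thesis .
  qed
  moreover have "B > 0" by (simp add: B_def)
  ultimately show ?thesis by blast
qed

lemma exists_distinct_vec: "\<exists>x y :: real ^ 'n. x \<noteq> y"
  by (intro exI[of _ 0] exI[of _ 1]) simp

text \<open>
  A real supremum says nothing about an unbounded set; \<open>holder s f\<close> supplies the upper bound here.
\<close>

lemma holder_seminorm_le_1D:
  fixes f :: "real ^ 'n \<Rightarrow> complex"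
  assumes f: "holder s f" "holder_seminorm s f \<le> 1"
  shows "cmod (f x - f y) \<le> norm (x - y) powr s"
proof (cases "x = y")
  case False
  let ?S = "{cmod (f x - f y) / norm (x - y) powr s | x y. x \<noteq> y}"
  obtain C where "\<And>x y. cmod (f x - f y) \<le> C * norm (x - y) powr s"
    using f(1) by (auto simp: holder_def)
  then have "bdd_above ?S" by (intro bdd_aboveI[of _ C]) (auto simp: divide_le_eq)
  then have "cmod (f x - f y) / norm (x - y) powr s \<le> Sup ?S"
    using False by (intro cSup_upper) auto
  also have "\<dots> \<le> 1" using f(2) by (simp add: holder_seminorm_def)
  finally show ?thesis using False by (simp add: divide_le_eq)
qed simp

lemma holder_seminorm_le_1I:
  fixes f :: "real ^ 'n \<Rightarrow> complex"
  assumes f: "\<And>x y. cmod (f x - f y) \<le> norm (x - y) powr s"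
  shows "holder s f" "holder_seminorm s f \<le> 1"
proof -
  show "holder s f" unfolding holder_def using f by (intro exI[of _ 1]) simp
  show "holder_seminorm s f \<le> 1"
    unfolding holder_seminorm_def
    by (rule cSup_least) (use f exists_distinct_vec in \<open>auto simp: divide_le_eq\<close>)
qed

lemma continuous_Holder:
  fixes f :: "'a::real_normed_vector \<Rightarrow> 'b::real_normed_vector"
  assumes s: "0 < s" and f: "\<And>x y. norm (f x - f y) \<le> norm (x - y) powr s"
  shows "continuous_on UNIV f"
  unfolding continuous_on_iff
proof (intro ballI allI impI)
  fix x and e :: real
  assume e: "0 < e"
  have "dist (f y) (f x) < e" if "dist y x < e powr (1 / s)" for y
  proof -
    have "norm (y - x) powr s < (e powr (1 / s)) powr s"
      using that s by (intro powr_less_mono2) (auto simp: dist_norm)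
    also have "\<dots> = e" using s e by (simp add: powr_powr)
    finally show ?thesis using f[of y x] by (simp add: dist_norm)
  qed
  then show "\<exists>d>0. \<forall>y\<in>UNIV. dist y x < d \<longrightarrow> dist (f y) (f x) < e"
    using e by (intro exI[of _ "e powr (1 / s)"]) auto
qed

section \<open>The easy half of Kantorovich duality\<close>

text \<open>
  An infimum of costs equal to \<open>\<infinity>\<close> would be read as \<open>0\<close> by \<open>wasserstein\<close>. The product measure is
  a coupling of finite cost when both marginals live on a compact set, which rules this out.
\<close>

lemma product_coupling:
  fixes \<mu> \<nu> :: "(real ^ 'n) measure"
  assumes "prob_space \<mu>" "prob_space \<nu>" and sets: "sets \<mu> = sets borel" "sets \<nu> = sets borel"
  shows "\<mu> \<Otimes>\<^sub>M \<nu> \<in> couplings \<mu> \<nu>"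
proof -
  interpret M: prob_space \<mu> by fact
  interpret N: prob_space \<nu> by fact
  interpret pair_prob_space \<mu> \<nu> ..
  have "sets (\<mu> \<Otimes>\<^sub>M \<nu>) = sets (borel \<Otimes>\<^sub>M borel)" by (intro sets_pair_measure_cong sets)
  then have "sets (\<mu> \<Otimes>\<^sub>M \<nu>) = sets borel" by (simp only: borel_prod)
  moreover have "distr (\<mu> \<Otimes>\<^sub>M \<nu>) borel fst = \<mu>"
    using N.distr_pair_fst[of \<mu>] distr_cong[of _ _ borel \<mu> fst] sets by metis
  moreover have "distr (\<mu> \<Otimes>\<^sub>M \<nu>) borel snd = \<nu>"
  proof -
    have "distr (\<mu> \<Otimes>\<^sub>M \<nu>) \<nu> snd
        = distr (\<nu> \<Otimes>\<^sub>M \<mu>) \<nu> (snd \<circ> (\<lambda>(x, y). (y, x)))"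
      by (subst distr_pair_swap, subst distr_distr) auto
    also have "snd \<circ> (\<lambda>(x, y). (y, x)) = fst" by auto
    also have "distr (\<nu> \<Otimes>\<^sub>M \<mu>) \<nu> fst = \<nu>" by (rule M.distr_pair_fst)
    finally show ?thesis using distr_cong[of _ _ borel \<nu> snd] sets by metis
  qed
  ultimately show ?thesis
    using P.prob_space_axioms by (simp add: couplings_def)
qed

text \<open>
  Under any coupling, \<open>\<integral> f d\<mu> - \<integral> f d\<nu>\<close> is the integral of \<open>f x - f y\<close>, which the transport cost
  dominates pointwise.
\<close>

lemma wasserstein_ge:
  fixes f :: "real ^ 'n \<Rightarrow> complex"
  assumes K: "compact K" and s: "0 < s"
    and \<mu>: "\<mu> \<in> P_ab2 K" and \<nu>: "\<nu> \<in> P_ab2 K"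
    and f: "\<And>x y. cmod (f x - f y) \<le> norm (x - y) powr s"
  shows "cmod (integral\<^sup>L \<mu> f - integral\<^sup>L \<nu> f) \<le> wasserstein s \<mu> \<nu>"
proof -
  let ?cost = "\<lambda>(x, y). ennreal (norm (x - y :: real ^ 'n) powr s)"
  have cont: "continuous_on UNIV f" by (rule continuous_Holder[OF s f])
  have fm [measurable]: "f \<in> borel_measurable borel" by (rule borel_measurable_continuous_onI[OF cont])
  have "bounded (f ` K)"
    by (intro compact_imp_bounded compact_continuous_image continuous_on_subset[OF cont] K) auto
  then obtain B where B: "\<And>x. x \<in> K \<Longrightarrow> cmod (f x) \<le> B" by (auto simp: bounded_iff)
  obtain R where R: "\<And>x. x \<in> K \<Longrightarrow> norm x \<le> R"
    using compact_imp_bounded[OF K] by (auto simp: bounded_iff)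
  have AEK: "AE x in \<kappa>. x \<in> K" if "\<kappa> \<in> P_ab2 K" for \<kappa> :: "(real ^ 'n) measure"
    using that K by (intro AE_I[of _ _ "- K"])
      (auto simp: P_ab2_def intro!: borel_closed compact_imp_closed borel_comp)
  have int: "integrable \<kappa> f" if "\<kappa> \<in> P_ab2 K" for \<kappa> :: "(real ^ 'n) measure"
  proof -
    interpret prob_space \<kappa> using that by (simp add: P_ab2_def)
    have "sets \<kappa> = sets borel" using that by (simp add: P_ab2_def)
    then show ?thesis
      using AEK[OF that] B fm
      by (intro integrable_const_bound[of _ B]) (auto elim!: eventually_mono cong: measurable_cong_sets)
  qed
  have lower: "ennreal (cmod (integral\<^sup>L \<mu> f - integral\<^sup>L \<nu> f)) \<le> (\<integral>\<^sup>+z. ?cost z \<partial>\<gamma>)"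
    if "\<gamma> \<in> couplings \<mu> \<nu>" for \<gamma>
  proof -
    have sg: "sets \<gamma> = sets borel" and d: "distr \<gamma> borel fst = \<mu>" "distr \<gamma> borel snd = \<nu>"
      using that by (auto simp: couplings_def)
    have [measurable]: "fst \<in> measurable \<gamma> borel" "snd \<in> measurable \<gamma> borel"
      unfolding measurable_cong_sets[OF sg refl]
      by (intro borel_measurable_continuous_onI continuous_intros)+
    have i: "integrable \<gamma> (\<lambda>z. f (fst z))" "integrable \<gamma> (\<lambda>z. f (snd z))"
      using int[OF \<mu>] int[OF \<nu>] unfolding d[symmetric] by (simp_all add: integrable_distr_eq)
    have "integral\<^sup>L \<mu> f - integral\<^sup>L \<nu> f = (\<integral>z. f (fst z) - f (snd z) \<partial>\<gamma>)"
      using i unfolding d[symmetric] by (simp add: integral_distr)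
    then have "ennreal (cmod (integral\<^sup>L \<mu> f - integral\<^sup>L \<nu> f))
        \<le> (\<integral>\<^sup>+z. ennreal (cmod (f (fst z) - f (snd z))) \<partial>\<gamma>)"
      using integral_norm_bound_ennreal[of \<gamma> "\<lambda>z. f (fst z) - f (snd z)"] i by simp
    also have "\<dots> \<le> (\<integral>\<^sup>+z. ?cost z \<partial>\<gamma>)"
      by (intro nn_integral_mono) (auto simp: f split: prod.split intro!: ennreal_leI)
    finally show ?thesis .
  qed
  let ?I = "INF \<gamma>\<in>couplings \<mu> \<nu>. \<integral>\<^sup>+z. ?cost z \<partial>\<gamma>"
  have "?I < \<top>"
  proof -
    let ?\<gamma> = "\<mu> \<Otimes>\<^sub>M \<nu>"
    have g: "?\<gamma> \<in> couplings \<mu> \<nu>"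
      using \<mu> \<nu> by (intro product_coupling) (auto simp: P_ab2_def)
    then have sg: "sets ?\<gamma> = sets borel" and d: "distr ?\<gamma> borel fst = \<mu>" "distr ?\<gamma> borel snd = \<nu>"
      and "prob_space ?\<gamma>" by (auto simp: couplings_def)
    have meas: "fst \<in> measurable ?\<gamma> borel" "snd \<in> measurable ?\<gamma> borel"
      unfolding measurable_cong_sets[OF sg refl]
      by (intro borel_measurable_continuous_onI continuous_intros)+
    have "AE z in ?\<gamma>. fst z \<in> K" "AE z in ?\<gamma>. snd z \<in> K"
      using AE_distrD[OF meas(1)] AE_distrD[OF meas(2)] AEK[OF \<mu>] AEK[OF \<nu>]
      by (auto simp only: d)
    then have "AE z in ?\<gamma>. ?cost z \<le> ennreal ((2 * R) powr s)"
    proof eventually_elim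
      case (elim z)
      have "norm (fst z - snd z) \<le> 2 * R"
        using norm_triangle_ineq4[of "fst z" "snd z"] R[OF elim(1)] R[OF elim(2)] by simp
      then show ?case using s by (auto simp: case_prod_beta intro!: ennreal_leI powr_mono2)
    qed
    then have "(\<integral>\<^sup>+z. ?cost z \<partial>?\<gamma>) \<le> (\<integral>\<^sup>+z. ennreal ((2 * R) powr s) \<partial>?\<gamma>)"
      by (rule nn_integral_mono_AE)
    also have "\<dots> < \<top>"
      using prob_space.emeasure_space_1[OF \<open>prob_space ?\<gamma>\<close>] by simp
    finally show ?thesis using g by (meson INF_lower le_less_trans)
  qed
  moreover have "ennreal (cmod (integral\<^sup>L \<mu> f - integral\<^sup>L \<nu> f)) \<le> ?I"
    by (intro INF_greatest lower)
  ultimately have "enn2real (ennreal (cmod (integral\<^sup>L \<mu> f - integral\<^sup>L \<nu> f))) \<le> enn2real ?I"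
    by (intro enn2real_mono)
  then show ?thesis by (simp add: wasserstein_def)
qed

section \<open>Measures with bounded densities\<close>

definition bounded_density_on :: "(real ^ 'n) set \<Rightarrow> (real ^ 'n \<Rightarrow> real) \<Rightarrow> bool" where
  "bounded_density_on K p \<longleftrightarrow>
     p \<in> borel_measurable borel \<and> (\<forall>x. 0 \<le> p x) \<and> (\<exists>M. \<forall>x. p x \<le> M) \<and>
     (\<forall>x. x \<notin> K \<longrightarrow> p x = 0) \<and> (\<integral>x. p x \<partial>lborel) = 1"

lemma
  fixes p :: "real ^ 'n \<Rightarrow> real"
  assumes K: "compact K" and p: "bounded_density_on K p"
  shows density_in_P_ab2: "density lborel (\<lambda>x. ennreal (p x)) \<in> P_ab2 K"
    and lebesgue_density_density:
      "AE x in lborel. lebesgue_density (density lborel (\<lambda>x. ennreal (p x))) x = p x"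
proof -
  let ?\<mu> = "density lborel (\<lambda>x. ennreal (p x))"
  have [measurable]: "p \<in> borel_measurable borel" and p0: "\<And>x. 0 \<le> p x"
    and supp: "\<And>x. x \<notin> K \<Longrightarrow> p x = 0" and int1: "(\<integral>x. p x \<partial>lborel) = 1"
    using p by (auto simp: bounded_density_on_def)
  obtain M where M: "\<And>x. p x \<le> M" using p by (auto simp: bounded_density_on_def)
  obtain R where R: "\<And>x. x \<in> K \<Longrightarrow> norm x \<le> R"
    using compact_imp_bounded[OF K] by (auto simp: bounded_iff)
  have int: "integrable lborel p"
    using M p0 supp R by (intro integrable_bounded_support[of _ M R]) auto
  have int2: "integrable lborel (\<lambda>x. (p x)\<^sup>2)"
    using M p0 supp R by (intro integrable_bounded_support[of _ "M\<^sup>2" R]) (auto intro: power_mono)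
  show ae: "AE x in lborel. lebesgue_density ?\<mu> x = p x"
  proof -
    have "AE x in lborel. ennreal (p x) = RN_deriv lborel ?\<mu> x"
      by (rule sigma_finite_measure.RN_deriv_unique[OF sigma_finite_lborel]) simp_all
    then show ?thesis
      by (elim eventually_mono) (metis enn2real_ennreal lebesgue_density_def p0)
  qed
  have "prob_space ?\<mu>"
  proof
    have "emeasure ?\<mu> (space ?\<mu>) = (\<integral>\<^sup>+x. ennreal (p x) \<partial>lborel)"
      by (simp add: emeasure_density)
    also have "\<dots> = ennreal (\<integral>x. p x \<partial>lborel)"
      using p0 by (intro nn_integral_eq_integral int) simp
    finally show "emeasure ?\<mu> (space ?\<mu>) = 1" by (simp add: int1)
  qed
  moreover have "emeasure ?\<mu> (- K) = 0"
  proof -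
    have "- K \<in> sets borel" using K by (simp add: borel_closed compact_imp_closed borel_comp)
    then have "emeasure ?\<mu> (- K) = (\<integral>\<^sup>+x. ennreal (p x) * indicator (- K) x \<partial>lborel)"
      by (simp add: emeasure_density)
    also have "\<dots> = (\<integral>\<^sup>+x. 0 \<partial>(lborel :: (real ^ 'n) measure))"
      by (intro nn_integral_cong) (auto simp: indicator_def supp)
    finally show ?thesis by simp
  qed
  moreover have "absolutely_continuous lborel ?\<mu>"
    by (intro absolutely_continuousI_density) simp
  moreover have "integrable lborel (\<lambda>x. (lebesgue_density ?\<mu> x)\<^sup>2)"
  proof (rule integrable_cong_AE_imp[OF int2])
    show "(\<lambda>x. (lebesgue_density ?\<mu> x)\<^sup>2) \<in> borel_measurable lborel"
      unfolding lebesgue_density_def using borel_measurable_RN_deriv[of lborel] by simp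
    show "AE x in lborel. (p x)\<^sup>2 = (lebesgue_density ?\<mu> x)\<^sup>2"
      using ae by (elim eventually_mono) simp
  qed
  ultimately show "?\<mu> \<in> P_ab2 K" by (simp add: P_ab2_def)
qed

lemma wasserstein_density_ge:
  fixes f :: "real ^ 'n \<Rightarrow> complex"
  assumes K: "compact K" and s: "0 < s"
    and p: "bounded_density_on K p" and q: "bounded_density_on K q"
    and f: "\<And>x y. cmod (f x - f y) \<le> norm (x - y) powr s"
  shows "cmod (\<integral>x. f x * of_real (p x - q x) \<partial>lborel)
      \<le> wasserstein s (density lborel (\<lambda>x. ennreal (p x))) (density lborel (\<lambda>x. ennreal (q x)))"
proof -
  have cont: "continuous_on UNIV f" by (rule continuous_Holder[OF s f])
  have fm [measurable]: "f \<in> borel_measurable borel" by (rule borel_measurable_continuous_onI[OF cont])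
  have "bounded (f ` K)"
    by (intro compact_imp_bounded compact_continuous_image continuous_on_subset[OF cont] K) auto
  then obtain B where B: "\<And>x. x \<in> K \<Longrightarrow> cmod (f x) \<le> B" by (auto simp: bounded_iff)
  obtain R where R: "\<And>x. x \<in> K \<Longrightarrow> norm x \<le> R"
    using compact_imp_bounded[OF K] by (auto simp: bounded_iff)
  have *: "integrable lborel (\<lambda>x. g x *\<^sub>R f x) \<and>
      integral\<^sup>L (density lborel (\<lambda>x. ennreal (g x))) f = (\<integral>x. g x *\<^sub>R f x \<partial>lborel)"
    if g: "bounded_density_on K g" for g
  proof
    have [measurable]: "g \<in> borel_measurable borel" and g0: "\<And>x. 0 \<le> g x"
      and supp: "\<And>x. x \<notin> K \<Longrightarrow> g x = 0"
      using g by (auto simp: bounded_density_on_def)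
    obtain M where M: "\<And>x. g x \<le> M" using g by (auto simp: bounded_density_on_def)
    have "norm (g x *\<^sub>R f x) \<le> \<bar>M\<bar> * \<bar>B\<bar>" for x
    proof (cases "x \<in> K")
      case True
      have "g x * cmod (f x) \<le> \<bar>M\<bar> * \<bar>B\<bar>"
        using M[of x] B[OF True] g0[of x] by (intro mult_mono) auto
      then show ?thesis using g0[of x] by simp
    qed (simp add: supp)
    then show "integrable lborel (\<lambda>x. g x *\<^sub>R f x)"
      using supp R by (intro integrable_bounded_support[of _ "\<bar>M\<bar> * \<bar>B\<bar>" R]) force+
    show "integral\<^sup>L (density lborel (\<lambda>x. ennreal (g x))) f = (\<integral>x. g x *\<^sub>R f x \<partial>lborel)"
      by (intro integral_density) (auto simp: g0)
  qed
  have "(\<integral>x. f x * of_real (p x - q x) \<partial>lborel) = (\<integral>x. p x *\<^sub>R f x - q x *\<^sub>R f x \<partial>lborel)"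
    by (intro Bochner_Integration.integral_cong) (auto simp: scaleR_conv_of_real algebra_simps)
  also have "\<dots> = integral\<^sup>L (density lborel (\<lambda>x. ennreal (p x))) f
      - integral\<^sup>L (density lborel (\<lambda>x. ennreal (q x))) f"
    using *[OF p] *[OF q] by simp
  finally show ?thesis
    using wasserstein_ge[OF K s density_in_P_ab2[OF K p] density_in_P_ab2[OF K q] f] by simp
qed

section \<open>Test measures and the tight constant\<close>

text \<open>
  \<open>q\<close> is the uniform density on a ball inside \<open>K\<close>, and \<open>p\<close> perturbs it by a dilate of \<open>f\<close> supported in
  the same ball.
\<close>

lemma exists_test_densities:
  fixes f :: "real ^ 'n \<Rightarrow> complex"
  assumes "interior K \<noteq> {}"
    and [measurable]: "f \<in> borel_measurable borel" and real: "\<And>x. f x \<in> \<real>"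
    and M: "\<And>x. cmod (f x) \<le> M" and R: "\<And>x. f x \<noteq> 0 \<Longrightarrow> norm x \<le> R"
    and mean: "integral\<^sup>L lborel f = 0"
  shows "\<exists>j k c p q. 0 < c \<and> bounded_density_on K p \<and> bounded_density_on K q \<and>
    (\<forall>x. of_real (p x - q x) = of_real c * dilate f j k x)"
proof -
  let ?n = "real CARD('n)"
  obtain a \<rho> where \<rho>: "0 < \<rho>" and ball: "ball a \<rho> \<subseteq> K"
    using assms(1) by (auto simp: mem_interior)
  \<comment> \<open>After rounding \<open>2 ^ N a\<close> to a lattice point, at \<open>\<ell>\<^sup>1\<close>-distance at most \<open>n\<close>, the dilate is supported
    within \<open>(R + n) / 2 ^ N\<close> of \<open>a\<close>.\<close>
  obtain N :: nat where N: "(\<bar>R\<bar> + ?n) / \<rho> < 2 ^ N" using real_arch_pow[of 2] by auto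
  define j where "j = int N"
  have j: "(2::real) powi j = 2 ^ N" by (simp add: j_def)
  define k :: "int ^ 'n" where "k = (\<chi> i. \<lfloor>2 ^ N * a $ i\<rfloor>)"
  have k: "norm (2 ^ N *\<^sub>R a - lattice_vec k) \<le> ?n"
  proof -
    have "norm (2 ^ N *\<^sub>R a - lattice_vec k) \<le> (\<Sum>i\<in>(UNIV :: 'n set). \<bar>(2 ^ N *\<^sub>R a - lattice_vec k) $ i\<bar>)"
      by (rule norm_le_l1_cart)
    also have "\<dots> \<le> (\<Sum>i\<in>(UNIV :: 'n set). 1)"
    proof (rule sum_mono)
      fix i
      show "\<bar>(2 ^ N *\<^sub>R a - lattice_vec k) $ i\<bar> \<le> 1"
        unfolding lattice_vec_def k_def using floor_correct[of "2 ^ N * a $ i"]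
        by (simp add: abs_le_iff) linarith
    qed
    finally show ?thesis by simp
  qed
  let ?d = "dilate f j k"
  have supp: "x \<in> ball a \<rho>" if "?d x \<noteq> 0" for x
  proof -
    have "norm ((2 powi j) *\<^sub>R x - lattice_vec k) \<le> R" by (rule dilate_support[OF R that])
    then have "norm ((2::real) ^ N *\<^sub>R (x - a)) \<le> \<bar>R\<bar> + ?n"
      using norm_triangle_ineq4[of "(2 powi j) *\<^sub>R x - lattice_vec k" "2 ^ N *\<^sub>R a - lattice_vec k"] k
      by (simp add: j scaleR_diff_right)
    also have "\<dots> < \<rho> * 2 ^ N" using N \<rho> by (simp add: field_simps)
    finally show ?thesis by (simp add: dist_norm norm_minus_commute mult.commute)
  qed
  define v where "v = measure lborel (ball a \<rho>)"
  have v: "0 < v" unfolding v_def using \<rho> by (rule content_ball_pos)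
  define A where "A = 2 powr (?n * of_int j / 2) * \<bar>M\<bar>"
  have A: "0 \<le> A" by (simp add: A_def)
  have bound: "cmod (?d x) \<le> A" for x
    unfolding A_def by (rule dilate_bound) (meson M abs_ge_self order_trans)
  define c where "c = 1 / (v * (A + 1))"
  have c: "0 < c" using v A by (simp add: c_def)
  define q where "q x = indicator (ball a \<rho>) x / v" for x :: "real ^ 'n"
  define p where "p x = q x + c * Re (?d x)" for x
  have qd [measurable]: "q \<in> borel_measurable borel" unfolding q_def
    by (intro borel_measurable_divide borel_measurable_indicator borel_measurable_const) simp
  have pd [measurable]: "p \<in> borel_measurable borel" unfolding p_def by measurable
  \<comment> \<open>Both nonnegativity of \<open>p\<close> and its vanishing outside \<open>K\<close> follow from this one bound.\<close>
  have small: "\<bar>c * Re (?d x)\<bar> \<le> q x" for x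
  proof (cases "x \<in> ball a \<rho>")
    case True
    have "\<bar>c * Re (?d x)\<bar> \<le> c * (A + 1)"
      using c A bound[of x] abs_Re_le_cmod[of "?d x"]
      by (auto simp: abs_mult intro!: mult_left_mono)
    also have "\<dots> = 1 / v"
    proof -
      have "A + 1 \<noteq> 0" using A by linarith
      then show ?thesis by (simp add: c_def)
    qed
    finally show ?thesis using True by (simp add: q_def)
  next
    case False
    then have "?d x = 0" using supp by blast
    then show ?thesis using v by (simp add: q_def indicator_def)
  qed
  have q0: "0 \<le> q x" and q1: "q x \<le> 1 / v" for x
    using v by (auto simp: q_def indicator_def)
  have outside: "q x = 0" if "x \<notin> K" for x using that ball by (auto simp: q_def indicator_def)
  have intq: "has_bochner_integral lborel q 1"
  proof -
    have "has_bochner_integral lborel (\<lambda>x. indicator (ball a \<rho>) x / v) (v / v)"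
      unfolding v_def
      by (intro has_bochner_integral_divide_zero has_bochner_integral_real_indicator)
         (use emeasure_bounded_finite[of "ball a \<rho>"] in auto)
    then show ?thesis using v by (simp add: q_def [abs_def])
  qed
  have intd: "integrable lborel ?d"
    by (rule integrable_bounded_support[OF _ bound dilate_support_norm[OF R]]) simp_all
  have "integral\<^sup>L lborel ?d = 0"
    using integral_mult_dilate[of f "\<lambda>_. 1" j k] mean by simp
  then have "has_bochner_integral lborel (\<lambda>x. Re (?d x)) 0"
    using intd by (simp add: has_bochner_integral_iff)
  then have "has_bochner_integral lborel p (1 + c * 0)"
    unfolding p_def [abs_def]
    by (intro has_bochner_integral_add intq has_bochner_integral_mult_right)
  then have intp: "integral\<^sup>L lborel p = 1"
    by (simp add: has_bochner_integral_integral_eq)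
  have "bounded_density_on K q"
    using q0 q1 outside has_bochner_integral_integral_eq[OF intq]
    by (auto simp: bounded_density_on_def)
  moreover have "bounded_density_on K p"
    unfolding bounded_density_on_def
  proof (intro conjI allI impI exI[of _ "2 / v"] pd intp)
    fix x
    show "0 \<le> p x" "p x \<le> 2 / v" using small[of x] q1[of x] by (simp_all add: p_def)
    show "p x = 0" if "x \<notin> K" using small[of x] outside[OF that] by (simp add: p_def)
  qed
  moreover have "of_real (p x - q x) = of_real c * ?d x" for x
  proof -
    have "?d x \<in> \<real>" using real by (simp add: dilate_def)
    then show ?thesis by (simp add: p_def of_real_Re)
  qed
  ultimately show ?thesis using c by blast
qed

text \<open>
  The heart of the argument. The scale factors \<open>2 powr (- j s)\<close> from the Hoelder rescaling and
  \<open>2 powr (- n j / 2)\<close> from the substitution combine to the very weight that the wavelet distance gives to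
  scale \<open>j\<close>, so they cancel from the comparison.
\<close>

lemma Holder_pairing_bound:
  fixes \<psi> :: "'e \<Rightarrow> real ^ 'n \<Rightarrow> complex"
  assumes s: "0 < s" and sys: "orthonormal_wavelet_system \<phi> \<alpha> \<psi>"
    and meas: "\<And>\<epsilon>. \<epsilon> \<in> \<alpha> \<Longrightarrow> \<psi> \<epsilon> \<in> borel_measurable borel"
    and K: "compact K" "interior K \<noteq> {}" and C: "0 < C"
    and lower: "\<And>\<eta>. 0 < \<eta> \<Longrightarrow> \<exists>j\<^sub>0. \<forall>\<mu>\<in>P_ab2 K. \<forall>\<nu>\<in>P_ab2 K.
           C * wasserstein s \<mu> \<nu> - \<eta> \<le> wavelet_distance \<alpha> \<psi> j\<^sub>0 s \<mu> \<nu>"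
    and \<epsilon>: "\<epsilon> \<in> \<alpha>" and real: "\<And>x. \<psi> \<epsilon> x \<in> \<real>"
    and M: "\<And>x. cmod (\<psi> \<epsilon> x) \<le> M" and R: "\<And>x. \<psi> \<epsilon> x \<noteq> 0 \<Longrightarrow> norm x \<le> R"
    and F: "\<And>x y. cmod (F x - F y) \<le> norm (x - y) powr s"
  shows "C * cmod (\<integral>x. F x * \<psi> \<epsilon> x \<partial>lborel) \<le> 1"
proof -
  let ?n = "real CARD('n)" and ?I = "\<integral>x. F x * \<psi> \<epsilon> x \<partial>lborel"
  have [measurable]: "F \<in> borel_measurable borel"
    by (rule borel_measurable_continuous_onI[OF continuous_Holder[OF s F]])
  have "integral\<^sup>L lborel (\<psi> \<epsilon>) = 0"
    using sys \<epsilon> by (auto simp: orthonormal_wavelet_system_def has_bochner_integral_integral_eq)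
  then obtain j k c p q where c: "0 < c" and p: "bounded_density_on K p" and q: "bounded_density_on K q"
    and diff: "\<And>x. complex_of_real (p x - q x) = of_real c * dilate (\<psi> \<epsilon>) j k x"
    using exists_test_densities[OF K(2) meas[OF \<epsilon>] real M R] by blast
  let ?\<mu> = "density lborel (\<lambda>x. ennreal (p x))" and ?\<nu> = "density lborel (\<lambda>x. ennreal (q x))"
  define w where "w = 2 powr (- of_int j * (s + ?n / 2)) * c"
  have w: "0 < w" using c by (simp add: w_def)
  define b :: real where "b = 2 powr (- (of_int j * s))"
  define g where "g x = of_real b * F ((2 powi j) *\<^sub>R x - lattice_vec k)" for x
  have g: "cmod (g x - g y) \<le> norm (x - y) powr s" for x y
  proof -
    have "cmod (g x - g y) = b * cmod (F ((2 powi j) *\<^sub>R x - lattice_vec k) - F ((2 powi j) *\<^sub>R y - lattice_vec k))"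
      unfolding g_def by (simp add: b_def norm_mult flip: right_diff_distrib)
    also have "\<dots> \<le> b * norm ((2 powi j :: real) *\<^sub>R (x - y)) powr s"
      using F[of "(2 powi j) *\<^sub>R x - lattice_vec k" "(2 powi j) *\<^sub>R y - lattice_vec k"]
      by (intro mult_left_mono) (simp_all add: b_def scaleR_diff_right)
    also have "\<dots> = b * (2 powr (of_int j * s)) * norm (x - y) powr s"
      by (simp add: powr_mult powr_powr flip: powr_real_of_int')
    also have "b * (2 powr (of_int j * s)) = 1"
      unfolding b_def by (simp flip: powr_add)
    finally show ?thesis by simp
  qed
  have "(\<integral>x. g x * of_real (p x - q x) \<partial>lborel)
      = (\<integral>x. of_real (b * c) * (F ((2 powi j) *\<^sub>R x - lattice_vec k) * dilate (\<psi> \<epsilon>) j k x) \<partial>lborel)"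
    unfolding diff g_def by (simp add: mult_ac)
  also have "\<dots> = of_real (b * c) * (of_real (2 powr (- (?n * of_int j / 2))) * ?I)"
    by (subst integral_mult_right_zero, subst integral_mult_dilate) (simp_all add: meas \<epsilon>)
  also have "\<dots> = of_real (b * 2 powr (- (?n * of_int j / 2)) * c) * ?I"
    by simp
  also have "b * 2 powr (- (?n * of_int j / 2)) = 2 powr (- of_int j * (s + ?n / 2))"
    unfolding b_def by (simp add: algebra_simps flip: powr_add)
  finally have "w * cmod ?I = cmod (\<integral>x. g x * of_real (p x - q x) \<partial>lborel)"
    using c by (simp add: w_def norm_mult)
  then have W: "w * cmod ?I \<le> wasserstein s ?\<mu> ?\<nu>"
    using wasserstein_density_ge[OF K(1) s p q g] by simp
  have ae: "AE x in lborel. of_real (lebesgue_density ?\<mu> x - lebesgue_density ?\<nu> x)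
      = of_real c * dilate (\<psi> \<epsilon>) j k x"
    using lebesgue_density_density[OF K(1) p] lebesgue_density_density[OF K(1) q]
    by eventually_elim (simp only: diff)
  have "C * (w * cmod ?I) \<le> w + \<eta>" if \<eta>: "0 < \<eta>" for \<eta>
  proof -
    obtain j\<^sub>0 where "C * wasserstein s ?\<mu> ?\<nu> - \<eta> \<le> wavelet_distance \<alpha> \<psi> j\<^sub>0 s ?\<mu> ?\<nu>"
      using lower[OF \<eta>] density_in_P_ab2[OF K(1) p] density_in_P_ab2[OF K(1) q] by blast
    also have "\<dots> \<le> w"
      unfolding w_def using c by (intro wavelet_distance_single[OF sys \<epsilon> meas ae]) auto
    finally show ?thesis using mult_left_mono[OF W, of C] C by linarith
  qed
  then have "C * (w * cmod ?I) \<le> w" by (rule field_le_epsilon)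
  then have "w * (C * cmod ?I) \<le> w * 1" by (simp add: mult_ac)
  then show ?thesis using w by (simp only: mult_le_cancel_left_pos)
qed

lemma compactly_supported_bounded:
  "compactly_supported f \<Longrightarrow> \<exists>R. \<forall>x. f x \<noteq> 0 \<longrightarrow> norm x \<le> R"
  unfolding compactly_supported_def
  using compact_imp_bounded[of "closure {x. f x \<noteq> 0}"] closure_subset[of "{x. f x \<noteq> 0}"]
  by (fastforce simp: bounded_iff)

lemma wavelet_square_integral:
  fixes \<psi> :: "'e \<Rightarrow> real ^ 'n \<Rightarrow> complex"
  assumes "orthonormal_wavelet_system \<phi> \<alpha> \<psi>" "\<epsilon> \<in> \<alpha>" and real: "\<And>x. \<psi> \<epsilon> x \<in> \<real>"
  shows "(\<integral>x. \<psi> \<epsilon> x * \<psi> \<epsilon> x \<partial>lborel) = 1"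
proof -
  have 0: "lattice_vec 0 = (0 :: real ^ 'n)" by (simp add: lattice_vec_def vec_eq_iff)
  then have "dilate (\<psi> \<epsilon>) 0 0 = \<psi> \<epsilon>" by (simp add: dilate_def fun_eq_iff)
  then have "L2_inner (\<psi> \<epsilon>) (\<psi> \<epsilon>) = 1"
    using wavelet_orthonormal[OF assms(1,2,2), of 0 0 0 0] by simp
  moreover have "cnj (\<psi> \<epsilon> x) = \<psi> \<epsilon> x" for x using real[of x] by (simp add: Reals_cnj_iff)
  ultimately show ?thesis by (simp add: L2_inner_def)
qed

theorem mainTheorem3:
  fixes s C :: real and r :: nat and K :: "(real ^ 'n) set"
    and \<phi> :: "real ^ 'n \<Rightarrow> complex"
    and \<alpha> :: "'e set" and \<psi> :: "'e \<Rightarrow> real ^ 'n \<Rightarrow> complex"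
  assumes "0 < s" and "s < 1"
    and "orthonormal_wavelet_system \<phi> \<alpha> \<psi>"
    and "1 \<le> r" and "regular_wavelet_system r \<phi> \<alpha> \<psi>"
    and "compactly_supported_wavelet_system \<phi> \<alpha> \<psi>"
    and real_valued: "\<And>\<epsilon> x. \<epsilon> \<in> \<alpha> \<Longrightarrow> \<psi> \<epsilon> x \<in> \<real>"
    and "compact K" and "interior K \<noteq> {}"
    and "0 < C"
    and "\<And>\<eta>. 0 < \<eta> \<Longrightarrow> \<exists>j\<^sub>0. \<forall>\<mu>\<in>P_ab2 K. \<forall>\<nu>\<in>P_ab2 K.
           C * wasserstein s \<mu> \<nu> - \<eta> \<le> wavelet_distance \<alpha> \<psi> j\<^sub>0 s \<mu> \<nu>"
  shows "C \<le> E_const \<alpha> \<psi> s"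
proof -
  have meas: "\<psi> \<epsilon> \<in> borel_measurable borel" if "\<epsilon> \<in> \<alpha>" for \<epsilon>
  proof -
    obtain V where V: "multiresolution_approximation V \<phi>" and "\<forall>\<epsilon>\<in>\<alpha>. \<psi> \<epsilon> \<in> detail_space V 0"
      using assms(3) by (auto simp: orthonormal_wavelet_system_def)
    with that have "\<psi> \<epsilon> \<in> V 1" by (simp add: detail_space_def)
    moreover have "closed_L2_subspace (V 1)"
      using V by (simp add: multiresolution_approximation_def)
    ultimately have "\<psi> \<epsilon> \<in> L2_space" by (auto simp: closed_L2_subspace_def)
    then show ?thesis by (simp add: L2_space_def)
  qed
  have pairing: "C * cmod (\<integral>x. F x * \<psi> \<epsilon> x \<partial>lborel) \<le> 1"
    if \<epsilon>: "\<epsilon> \<in> \<alpha>" and F: "\<And>x y. cmod (F x - F y) \<le> norm (x - y) powr s" for \<epsilon> F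
  proof -
    obtain M where M: "\<And>x. cmod (\<psi> \<epsilon> x) \<le> M"
      using regular_function_bounded[of r "\<psi> \<epsilon>"] assms(5) \<epsilon> by (auto simp: regular_wavelet_system_def)
    obtain R where R: "\<And>x. \<psi> \<epsilon> x \<noteq> 0 \<Longrightarrow> norm x \<le> R"
      using compactly_supported_bounded[of "\<psi> \<epsilon>"] assms(6) \<epsilon>
      by (auto simp: compactly_supported_wavelet_system_def)
    show ?thesis
      by (rule Holder_pairing_bound[OF assms(1,3) meas assms(8,9,10,11) \<epsilon> real_valued[OF \<epsilon>] M R F])
  qed
  have norm: "0 < holder_dual_norm s (\<psi> \<epsilon>) \<and> C * holder_dual_norm s (\<psi> \<epsilon>) \<le> 1"
    if \<epsilon>: "\<epsilon> \<in> \<alpha>" for \<epsilon>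
  proof
    let ?S = "{cmod (\<integral>x. f x * \<psi> \<epsilon> x \<partial>lborel) | f. holder s f \<and> holder_seminorm s f \<le> 1}"
    have le: "y \<le> 1 / C" if y_in: "y \<in> ?S" for y
    proof -
      obtain f where y: "y = cmod (\<integral>x. f x * \<psi> \<epsilon> x \<partial>lborel)" and f: "holder s f" "holder_seminorm s f \<le> 1"
        using y_in by blast
      show ?thesis
        using pairing[of \<epsilon> f, OF \<epsilon> holder_seminorm_le_1D[OF f]] \<open>0 < C\<close> by (simp add: y field_simps)
    qed
    obtain B where B: "0 < B" "\<And>x y. cmod (\<psi> \<epsilon> x - \<psi> \<epsilon> y) \<le> B * norm (x - y) powr s"
      using regular_function_Holder[of r "\<psi> \<epsilon>" s] assms(1,2,4,5) \<epsilon>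
      by (auto simp: regular_wavelet_system_def)
    define f where "f x = \<psi> \<epsilon> x / of_real B" for x
    have "cmod (f x - f y) \<le> norm (x - y) powr s" for x y
      unfolding f_def using B by (simp add: norm_divide field_simps flip: diff_divide_distrib)
    then have f: "holder s f" "holder_seminorm s f \<le> 1" by (rule holder_seminorm_le_1I)+
    have "(\<integral>x. f x * \<psi> \<epsilon> x \<partial>lborel) = 1 / of_real B"
      unfolding f_def using wavelet_square_integral[OF assms(3) \<epsilon> real_valued[OF \<epsilon>]] by simp
    then have "cmod (\<integral>x. f x * \<psi> \<epsilon> x \<partial>lborel) = 1 / B"
      using B(1) by (simp add: norm_divide)
    then have mem: "1 / B \<in> ?S" using f by force
    have "1 / B \<le> Sup ?S" using mem le by (intro cSup_upper bdd_aboveI) auto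
    then show "0 < holder_dual_norm s (\<psi> \<epsilon>)"
      using B(1) unfolding holder_dual_norm_def by (meson divide_pos_pos less_le_trans zero_less_one)
    have "Sup ?S \<le> 1 / C" using mem le by (intro cSup_least) auto
    then show "C * holder_dual_norm s (\<psi> \<epsilon>) \<le> 1"
      using \<open>0 < C\<close> unfolding holder_dual_norm_def by (simp add: field_simps)
  qed
  obtain R where "\<And>x. \<phi> x \<noteq> 0 \<Longrightarrow> norm x \<le> R"
    using compactly_supported_bounded[of \<phi>] assms(6)
    by (auto simp: compactly_supported_wavelet_system_def)
  then have "\<alpha> \<noteq> {}" by (rule wavelet_index_nonempty[OF assms(3)])
  moreover have "finite \<alpha>" using assms(3) by (simp add: orthonormal_wavelet_system_def)
  ultimately have "Max ((\<lambda>\<epsilon>. holder_dual_norm s (\<psi> \<epsilon>)) ` \<alpha>) \<in> (\<lambda>\<epsilon>. holder_dual_norm s (\<psi> \<epsilon>)) ` \<alpha>"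
    by (intro Max_in) auto
  then obtain \<epsilon> where "\<epsilon> \<in> \<alpha>"
    and "Max ((\<lambda>\<epsilon>. holder_dual_norm s (\<psi> \<epsilon>)) ` \<alpha>) = holder_dual_norm s (\<psi> \<epsilon>)" by blast
  then show ?thesis using norm[of \<epsilon>] by (simp add: E_const_def field_simps)
qed

end
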